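(* Let $B$ be a finite set of simple permutations not containing $12$ or $21$. Then for every $n$ for which Algorithm 1 below computes $Si_n$, the set $Si_n$ equals the set of simple permutations of size $n$ belonging to $Av(B)$. Algorithm 1 (input $B$): set $Si_1=\{1\}$, $Si_2=\{12,21\}$, $Si_3=\emptyset$, $Si_4=\{2413,3142\}\setminus B$, and $n=5$. While $Si_{n-1}\neq\emptyset$ or $Si_{n-2}\neq\emptyset$: let $Si_n$ consist of (a) every simple permutation $\sigma$ of size $n$ obtained by inserting one point into some $\pi\in Si_{n-1}$ such that $\sigma\notin B$ and every simple permutation obtained from $\sigma$ by deleting one point belongs to $Si_{n-1}$; and (b) for each exceptional permutation in $Si_{n-2}$ of type $i$, the exceptional permutation of type $i$ and size $n$, provided it is not in $B$. Then increase $n$ by $1$.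
   Context: A permutation of size $n$ is a bijection $\sigma$ of $\{1,\dots,n\}$, written $\sigma=\sigma_1\cdots\sigma_n$. A permutation $\pi$ of size $k$ is a pattern of $\sigma$ if there exist indices $i_1<\dots<i_k$ with $\sigma_{i_1}\cdots\sigma_{i_k}$ order-isomorphic to $\pi$. Inserting a point into $\pi$ / deleting a point from $\sigma$ means forming the permutation of size one larger/smaller obtained by adding/removing one entry and standardizing. For a set $B$ of permutations, $Av(B)$ is the set of permutations containing no element of $B$ as a pattern. An interval of $\sigma$ is a set of consecutive positions $\{i,\dots,j\}$ such that $\{\sigma_i,\dots,\sigma_j\}$ is a set of consecutive integers; $\sigma$ is simple if its only intervals are singletons and the whole set of positions. For every $m\geq 2$ the exceptional permutations of size $2m$ are: type 1: $2\,4\,6\cdots(2m)\,1\,3\cdots(2m-1)$; type 2: $(2m-1)\,(2m-3)\cdots1\,(2m)\,(2m-2)\cdots2$; type 3: $(m+1)\,1\,(m+2)\,2\cdots(2m)\,m$; type 4: $m\,(2m)\,(m-1)\,(2m-1)\cdots1\,(m+1)$. A permutation is exceptional if it is one of these; its type is the corresponding index.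
   Formalization: The formal theorem also assumes that B does not contain the permutation 1; without this the claim is false, since for B = {1} the algorithm sets Si_1 = {1} while no permutation of size 1 lies in Av(B). *)

theory Defs
  imports
    "HOL-Library.Sublist"
    "HOL-Combinatorics.Multiset_Permutations"
begin

text \<open>
  Permutations are lists of natural numbers in one-line notation. Their values start at 1 and their
  size is at least 1; positions are list indices and start at 0.
\<close>

definition perm :: "nat list \<Rightarrow> bool" where
  "perm \<sigma> \<longleftrightarrow> \<sigma> \<noteq> [] \<and> \<sigma> \<in> permutations_of_set {1..length \<sigma>}"

definition order_isomorphic :: "nat list \<Rightarrow> nat list \<Rightarrow> bool" where
  "order_isomorphic xs ys \<longleftrightarrow> length xs = length ys \<and>
     (\<forall>i<length xs. \<forall>j<length xs. xs ! i < xs ! j \<longleftrightarrow> ys ! i < ys ! j)"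

definition is_pattern :: "nat list \<Rightarrow> nat list \<Rightarrow> bool" where
  "is_pattern \<pi> \<sigma> \<longleftrightarrow> (\<exists>s. subseq s \<sigma> \<and> order_isomorphic s \<pi>)"

definition Av :: "nat list set \<Rightarrow> nat list set" where
  "Av B = {\<sigma>. perm \<sigma> \<and> (\<forall>\<beta>\<in>B. \<not> is_pattern \<beta> \<sigma>)}"

definition standardize :: "nat list \<Rightarrow> nat list" where
  "standardize xs = map (\<lambda>x. card {y \<in> set xs. y \<le> x}) xs"

definition delete_point :: "nat \<Rightarrow> nat list \<Rightarrow> nat list" where
  "delete_point i \<sigma> = standardize (take i \<sigma> @ drop (Suc i) \<sigma>)"

text \<open>
  The new entry has position \<open>i\<close> and value \<open>v\<close> in the resulting permutation; the old entries with
  value at least \<open>v\<close> move up by one, which is the standardization.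
\<close>

definition insert_point :: "nat \<Rightarrow> nat \<Rightarrow> nat list \<Rightarrow> nat list" where
  "insert_point i v \<pi> =
     (let \<pi>' = map (\<lambda>x. if x < v then x else Suc x) \<pi> in take i \<pi>' @ v # drop i \<pi>')"

definition deletions :: "nat list \<Rightarrow> nat list set" where
  "deletions \<sigma> = {delete_point i \<sigma> | i. i < length \<sigma>}"

definition insertions :: "nat list \<Rightarrow> nat list set" where
  "insertions \<pi> = {insert_point i v \<pi> | i v. i \<le> length \<pi> \<and> v \<in> {1..Suc (length \<pi>)}}"

definition perm_interval :: "nat list \<Rightarrow> nat set \<Rightarrow> bool" where
  "perm_interval \<sigma> I \<longleftrightarrow>
     (\<exists>i j. i \<le> j \<and> j < length \<sigma> \<and> I = {i..j}) \<and> (\<exists>a b. (!) \<sigma> ` I = {a..b})"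

text \<open>
  The permutations 1, 12 and 21 are simple. A basis containing 1 has no permutation of positive size
  in its class, so 1 has to be excluded from bases along with 12 and 21.
\<close>

definition simple :: "nat list \<Rightarrow> bool" where
  "simple \<sigma> \<longleftrightarrow> perm \<sigma> \<and>
     (\<forall>I. perm_interval \<sigma> I \<longrightarrow> is_singleton I \<or> I = {..<length \<sigma>})"

datatype exc_type = Type1 | Type2 | Type3 | Type4

text \<open>
  \<open>exceptional t m\<close> is the exceptional permutation of type \<open>t\<close> and size \<open>2 * m\<close>; it is only
  meaningful for \<open>m \<ge> 2\<close>. The types are distinct as permutations except in size 4, where types 1
  and 4 both give 2413 and types 2 and 3 both give 3142.
\<close>

fun exceptional :: "exc_type \<Rightarrow> nat \<Rightarrow> nat list" where
  "exceptional Type1 m = map (\<lambda>k. 2 * k) [1..<Suc m] @ map (\<lambda>k. 2 * k - 1) [1..<Suc m]"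
| "exceptional Type2 m = map (\<lambda>k. 2 * k - 1) (rev [1..<Suc m]) @ map (\<lambda>k. 2 * k) (rev [1..<Suc m])"
| "exceptional Type3 m = concat (map (\<lambda>k. [m + k, k]) [1..<Suc m])"
| "exceptional Type4 m = concat (map (\<lambda>k. [k, m + k]) (rev [1..<Suc m]))"

text \<open>
  The body of the loop: \<open>S1\<close> and \<open>S2\<close> stand for the sets computed for \<open>n - 1\<close> and \<open>n - 2\<close>. A
  permutation of size 4 has two types, and then both contribute to the second set.
\<close>

definition loop_body ::
    "nat list set \<Rightarrow> nat \<Rightarrow> nat list set \<Rightarrow> nat list set \<Rightarrow> nat list set" where
  "loop_body B n S1 S2 =
     {\<sigma>. simple \<sigma> \<and> length \<sigma> = n \<and> (\<exists>\<pi>\<in>S1. \<sigma> \<in> insertions \<pi>) \<and> \<sigma> \<notin> B \<and>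
         (\<forall>\<tau>\<in>deletions \<sigma>. simple \<tau> \<longrightarrow> \<tau> \<in> S1)} \<union>
     {exceptional t (Suc m) | t m.
         2 \<le> m \<and> 2 * Suc m = n \<and> exceptional t m \<in> S2 \<and> exceptional t (Suc m) \<notin> B}"

text \<open>
  \<open>computes B n S\<close>: on input \<open>B\<close> the algorithm computes a set \<open>Si\<^sub>n\<close>, and that set is \<open>S\<close>. The
  iteration for \<open>n\<close> is reached exactly if the sets for \<open>n - 1\<close> and \<open>n - 2\<close> have been computed and
  the loop condition holds.
\<close>

inductive computes :: "nat list set \<Rightarrow> nat \<Rightarrow> nat list set \<Rightarrow> bool" for B where
  init1: "computes B 1 {[1]}"
| init2: "computes B 2 {[1, 2], [2, 1]}"
| init3: "computes B 3 {}"
| init4: "computes B 4 ({[2, 4, 1, 3], [3, 1, 4, 2]} - B)"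
| loop: "5 \<le> n \<Longrightarrow> computes B (n - 1) S1 \<Longrightarrow> computes B (n - 2) S2 \<Longrightarrow> S1 \<noteq> {} \<or> S2 \<noteq> {} \<Longrightarrow>
     computes B n (loop_body B n S1 S2)"

end

theory Submission
  imports Defs
begin

text \<open>
  Colour a pair of positions of a permutation by the relative order of the two positions and of the
  two values. Intervals are then the homogeneous sets of this colouring and simple means prime, so
  that patterns become embeddings and all symmetries of permutations disappear. A simple pattern
  \<open>\<beta>\<close> of a simple \<open>\<sigma>\<close> is a prime subset, and prime sets can be enlarged two points at a time; hence
  a deletion of one or of two points of \<open>\<sigma>\<close> is simple and contains \<open>\<beta>\<close>. If no deletion of one point
  does, the pairs that can be deleted form a path through all points, and along this path the
  colour of a pair depends only on the parities of its indices. The permutations of this kind are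
  the exceptional ones. So every simple \<open>\<sigma>\<close> of size at least 5 is exceptional or has, for each
  proper simple pattern, a simple one-point deletion that contains the pattern. Exceptional
  permutations have no simple one-point deletions, and their proper simple patterns are contained
  in the next smaller one of the same type.
\<close>

section \<open>Prime sets\<close>

text \<open>Simplicity of a deletion alone is not enough: the loop inspects only one-point
  deletions, so a basis element \<beta> inside \<sigma> is noticed only if some simple deletion
  still contains it. Hence a prime set \<open>X\<close>, the copy of \<beta>, is carried through the
  structure theory. It is carried up to embedding rather than as a fixed subset, because exchanging
  two indistinguishable points moves the copy; with fixed subsets the path could not be prolonged.
  There are four exceptional types for a numerical reason. A pair of positions has one of four
  colours, and the path is described by two colours \<open>A\<close> and \<open>B\<close>, where
  \<open>A\<close> is neither \<open>B\<close> nor the reverse of \<open>B\<close>. This leaves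
  eight pairs, and reading the path backwards identifies them two by two. That the loop misses
  nothing follows by applying the same dichotomy to a pattern of size 4. It therefore needs that
  every simple permutation with at least three points contains 2413 or 3142, which is the theorem on
  separable permutations and also the reason why Si_3 is empty.\<close>

definition homogeneous :: "('a \<Rightarrow> 'a \<Rightarrow> 'c) \<Rightarrow> 'a set \<Rightarrow> 'a set \<Rightarrow> bool" where
  "homogeneous c V M \<longleftrightarrow> M \<subseteq> V \<and> (\<forall>v\<in>V - M. \<forall>a\<in>M. \<forall>b\<in>M. c v a = c v b)"

lemma homogeneousI:
  assumes "M \<subseteq> V" "\<And>v w. v \<in> V - M \<Longrightarrow> w \<in> M \<Longrightarrow> c v w = c v a"
  shows "homogeneous c V M"
  unfolding homogeneous_def using assms by metis

definition prime_set :: "('a \<Rightarrow> 'a \<Rightarrow> 'c) \<Rightarrow> 'a set \<Rightarrow> bool" where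
  "prime_set c V \<longleftrightarrow> (\<forall>M. homogeneous c V M \<longrightarrow> M = {} \<or> (\<exists>a. M = {a}) \<or> M = V)"

text \<open>The diagonal is left out: homogeneity compares \<open>c v a\<close> only for
  \<open>v\<close> outside and \<open>a\<close> inside a set, so the values \<open>c a a\<close>
  carry no information.\<close>

definition embeds :: "('a \<Rightarrow> 'a \<Rightarrow> 'c) \<Rightarrow> 'a set \<Rightarrow> ('b \<Rightarrow> 'b \<Rightarrow> 'c) \<Rightarrow> 'b set \<Rightarrow> bool" where
  "embeds c X d Y \<longleftrightarrow> (\<exists>f. inj_on f X \<and> f ` X \<subseteq> Y \<and>
     (\<forall>a\<in>X. \<forall>b\<in>X. a \<noteq> b \<longrightarrow> d (f a) (f b) = c a b))"

lemma embeds_refl: "X \<subseteq> Y \<Longrightarrow> embeds c X c Y"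
  unfolding embeds_def by (intro exI[of _ id]) auto

lemma embeds_trans:
  assumes "embeds c X d Y" "embeds d Y e Z"
  shows "embeds c X e Z"
proof -
  obtain f where f: "inj_on f X" "f ` X \<subseteq> Y" "\<forall>a\<in>X. \<forall>b\<in>X. a \<noteq> b \<longrightarrow> d (f a) (f b) = c a b"
    using assms(1) unfolding embeds_def by blast
  obtain g where g: "inj_on g Y" "g ` Y \<subseteq> Z" "\<forall>a\<in>Y. \<forall>b\<in>Y. a \<noteq> b \<longrightarrow> e (g a) (g b) = d a b"
    using assms(2) unfolding embeds_def by blast
  have "inj_on (g \<circ> f) X"
    using f g by (meson comp_inj_on inj_on_subset)
  moreover have "e (g (f a)) (g (f b)) = c a b" if "a \<in> X" "b \<in> X" "a \<noteq> b" for a b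
  proof -
    have "f a \<noteq> f b" using f(1) that by (meson inj_on_eq_iff)
    then show ?thesis using f(2,3) g(3) that by (simp add: image_subset_iff)
  qed
  ultimately show ?thesis
    unfolding embeds_def using f(2) g(2) by (intro exI[of _ "g \<circ> f"]) (auto simp: image_subset_iff)
qed

lemma embeds_mono: "embeds c X d Y \<Longrightarrow> Y \<subseteq> Z \<Longrightarrow> embeds c X d Z"
  by (meson embeds_refl embeds_trans)

lemma prime_set_image:
  assumes inj: "inj_on f X" and col: "\<And>a b. a \<in> X \<Longrightarrow> b \<in> X \<Longrightarrow> a \<noteq> b \<Longrightarrow> d (f a) (f b) = c a b"
    and prime: "prime_set c X"
  shows "prime_set d (f ` X)"
  unfolding prime_set_def
proof (intro allI impI)
  fix M assume M: "homogeneous d (f ` X) M"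
  define N where "N = {x \<in> X. f x \<in> M}"
  have MN: "M = f ` N" using M unfolding N_def homogeneous_def by auto
  have "homogeneous c X N"
    unfolding homogeneous_def
  proof (intro conjI ballI)
    fix v a b assume v: "v \<in> X - N" and a: "a \<in> N" and b: "b \<in> N"
    have "d (f v) (f a) = d (f v) (f b)"
      using M v a b unfolding homogeneous_def N_def by auto
    moreover have "v \<noteq> a" "v \<noteq> b" using v a b by auto
    ultimately show "c v a = c v b" using col v a b unfolding N_def by auto
  qed (auto simp: N_def)
  then have "N = {} \<or> (\<exists>a. N = {a}) \<or> N = X" using prime unfolding prime_set_def by blast
  then show "M = {} \<or> (\<exists>a. M = {a}) \<or> M = f ` X" using MN by auto
qed

text \<open>Source of the later case distinctions: when \<open>W\<close> is all but one or two
  points of the ground set, the three possible traces leave only a handful of candidates for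
  \<open>M\<close>.\<close>

lemma prime_set_Int:
  assumes "prime_set c W" "homogeneous c V M" "W \<subseteq> V"
  shows "M \<inter> W = {} \<or> (\<exists>a. M \<inter> W = {a}) \<or> W \<subseteq> M"
proof -
  have "homogeneous c W (M \<inter> W)" using assms(2,3) unfolding homogeneous_def by blast
  then show ?thesis using assms(1) unfolding prime_set_def by blast
qed

lemma prime_set_large:
  assumes "prime_set c V" "homogeneous c V M" "x \<in> M" "y \<in> M" "x \<noteq> y"
  shows "M = V"
  using assms unfolding prime_set_def by (metis empty_iff singletonD)

text \<open>The two defects that can prevent a point from enlarging a prime set: for points of
  \<open>V\<close>, \<open>twins\<close> makes \<open>{y, z}\<close> homogeneous and
  \<open>uniform\<close> makes \<open>V - {y}\<close> homogeneous. Neither notion requires the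
  points to lie in \<open>V\<close>, so both also describe how points outside a prime set see
  it.\<close>

definition twins :: "('a \<Rightarrow> 'a \<Rightarrow> 'c) \<Rightarrow> 'a set \<Rightarrow> 'a \<Rightarrow> 'a \<Rightarrow> bool" where
  "twins c V y z \<longleftrightarrow> (\<forall>v\<in>V - {y, z}. c v y = c v z)"

definition uniform :: "('a \<Rightarrow> 'a \<Rightarrow> 'c) \<Rightarrow> 'a set \<Rightarrow> 'a \<Rightarrow> bool" where
  "uniform c V y \<longleftrightarrow> (\<forall>v\<in>V - {y}. \<forall>w\<in>V - {y}. c y v = c y w)"

lemma twinsD: "twins c V y z \<Longrightarrow> v \<in> V \<Longrightarrow> v \<noteq> y \<Longrightarrow> v \<noteq> z \<Longrightarrow> c v y = c v z"
  unfolding twins_def by blast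

lemma uniformD:
  "uniform c V y \<Longrightarrow> v \<in> V \<Longrightarrow> w \<in> V \<Longrightarrow> v \<noteq> y \<Longrightarrow> w \<noteq> y \<Longrightarrow> c y v = c y w"
  unfolding uniform_def by blast

lemma uniformI:
  "(\<And>v w. v \<in> V \<Longrightarrow> w \<in> V \<Longrightarrow> v \<noteq> y \<Longrightarrow> w \<noteq> y \<Longrightarrow> c y v = c y w) \<Longrightarrow> uniform c V y"
  unfolding uniform_def by blast

lemma card_ge_2_obtain:
  assumes "2 \<le> card A"
  obtains a b where "a \<in> A" "b \<in> A" "a \<noteq> b"
  using assms by (metis One_nat_def Suc_1 card_le_Suc0_iff_eq card.infinite not_less_eq_eq zero_le)

text \<open>Three points are needed because a set of two points is prime although its points are
  twins.\<close>

lemma prime_set_not_twins: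
  assumes "prime_set c V" "y \<in> V" "z \<in> V" "y \<noteq> z" "3 \<le> card V"
  shows "\<not> twins c V y z"
proof
  assume "twins c V y z"
  then have "homogeneous c V {y, z}" using assms unfolding twins_def homogeneous_def by auto
  then have "{y, z} = V" using prime_set_large[OF assms(1)] assms(4) by blast
  moreover have "card {y, z} \<le> 2" by (simp add: card_insert_if)
  ultimately show False using assms(5) by simp
qed

lemma prime_set_not_uniform:
  assumes "prime_set c V" "y \<in> V" "3 \<le> card V"
  shows "\<not> uniform c V y"
proof
  assume "uniform c V y"
  then have "homogeneous c V (V - {y})" unfolding uniform_def homogeneous_def by auto
  moreover have "2 \<le> card (V - {y})" using assms by (simp add: card_Diff_singleton)
  then have "\<exists>a b. a \<in> V - {y} \<and> b \<in> V - {y} \<and> a \<noteq> b"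
    by (meson card_ge_2_obtain)
  ultimately have "V - {y} = V" using prime_set_large[OF assms(1)] by blast
  then show False using assms(2) by blast
qed

text \<open>What remains of two linear orders once the colours are opaque: the colour of a pair
  determines that of the reversed pair, no colour is its own reverse, and every colour class is
  transitive. Nothing here tells the two orders or their directions apart, so one argument covers
  all symmetries.\<close>

locale order_colouring =
  fixes c :: "'a \<Rightarrow> 'a \<Rightarrow> 'c"
  assumes col_rev: "a \<noteq> b \<Longrightarrow> a' \<noteq> b' \<Longrightarrow> c a b = c a' b' \<Longrightarrow> c b a = c b' a'"
    and col_asym: "a \<noteq> b \<Longrightarrow> c a b \<noteq> c b a"
    and col_trans: "a \<noteq> b \<Longrightarrow> b \<noteq> d \<Longrightarrow> c a b = s \<Longrightarrow> c b d = s \<Longrightarrow> c a d = s"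
begin

lemma twins_rev: "twins c V y z \<Longrightarrow> v \<in> V \<Longrightarrow> v \<noteq> y \<Longrightarrow> v \<noteq> z \<Longrightarrow> c y v = c z v"
  using col_rev twinsD by metis

text \<open>
  This is a theorem of Ehrenfeucht and Rozenberg.
\<close>

lemma prime_set_extend_two:
  assumes V: "prime_set c V" and X: "prime_set c X" "X \<subseteq> V" "3 \<le> card X" and two: "2 \<le> card (V - X)"
  shows "\<exists>x\<in>V - X. \<exists>y\<in>V - X. x \<noteq> y \<and> prime_set c (insert x (insert y X))"
proof (rule ccontr)
  assume neg: "\<not> ?thesis"
  \<comment> \<open>Two twins of \<open>v\<close> inside \<open>X\<close> would be twins of each
    other, and the prime set \<open>X\<close> has none.\<close>
  have tw_unique: "u = u'" if "twins c X u v" "twins c X u' v" "u \<in> X" "u' \<in> X" "v \<notin> X" for u u' v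
  proof (rule ccontr)
    assume "u \<noteq> u'"
    have "c w u = c w u'" if "w \<in> X - {u, u'}" for w
    proof -
      have "w \<noteq> v" using that \<open>v \<notin> X\<close> by blast
      then have "c w u = c w v" "c w u' = c w v"
        using that \<open>twins c X u v\<close> \<open>twins c X u' v\<close> unfolding twins_def by auto
      then show ?thesis by simp
    qed
    then have "twins c X u u'" unfolding twins_def by blast
    then show False using prime_set_not_twins[OF X(1) _ _ \<open>u \<noteq> u'\<close> X(3)] that by simp
  qed
  have not_both: "\<not> twins c X u v" if "uniform c X v" "u \<in> X" "v \<notin> X" for u v
  proof
    assume "twins c X u v"
    have "uniform c X u"
    proof (rule uniformI)
      fix a b assume ab: "a \<in> X" "b \<in> X" "a \<noteq> u" "b \<noteq> u"
      then have "a \<noteq> v" "b \<noteq> v" using that by blast+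
      then have "c u a = c v a" "c u b = c v b" "c v a = c v b"
        using twins_rev[OF \<open>twins c X u v\<close>] uniformD[OF that(1)] ab by blast+
      then show "c u a = c u b" by simp
    qed
    then show False using prime_set_not_uniform[OF X(1) _ X(3)] that by simp
  qed
  \<comment> \<open>The disjuncts list the homogeneous sets that can spoil the primality of
    \<open>X\<close> with \<open>x\<close> and \<open>y\<close>: in this order
    \<open>{x, y}\<close>, \<open>{u, x}\<close>, \<open>{u, y}\<close>, \<open>{u, x, y}\<close>,
    \<open>X\<close> with \<open>x\<close>, \<open>X\<close> with \<open>y\<close>, and
    \<open>X\<close> itself.\<close>
  have pair: "twins c X x y \<or> (\<exists>u\<in>X. twins c X u x \<and> c y u = c y x)
      \<or> (\<exists>u\<in>X. twins c X u y \<and> c x u = c x y) \<or> (\<exists>u\<in>X. twins c X u x \<and> twins c X u y)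
      \<or> (uniform c (insert x X) y) \<or> (uniform c (insert y X) x) \<or> (uniform c X x \<and> uniform c X y)"
    if xy: "x \<in> V - X" "y \<in> V - X" "x \<noteq> y" for x y
  proof -
    let ?Y = "insert x (insert y X)"
    have "\<not> prime_set c ?Y" using neg xy by blast
    then obtain M where M: "homogeneous c ?Y M" "M \<noteq> {}" "\<not> (\<exists>a. M = {a})" "M \<noteq> ?Y"
      unfolding prime_set_def by blast
    have sub: "M \<subseteq> ?Y" and hom: "\<And>v a b. v \<in> ?Y - M \<Longrightarrow> a \<in> M \<Longrightarrow> b \<in> M \<Longrightarrow> c v a = c v b"
      using M(1) unfolding homogeneous_def by blast+
    have "M \<inter> X = {} \<or> (\<exists>a. M \<inter> X = {a}) \<or> X \<subseteq> M" using prime_set_Int[OF X(1) M(1)] by blast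
    then consider "M \<inter> X = {}" | u where "M \<inter> X = {u}" | "X \<subseteq> M" by blast
    then show ?thesis
    proof cases
      case 1
      then have "M = {x, y}" using sub M(2,3) by blast
      then have "twins c X x y" using hom xy unfolding twins_def by auto
      then show ?thesis by blast
    next
      case 2
      then have u: "u \<in> X" "u \<in> M" by blast+
      have "M = {u} \<or> M = {u, x} \<or> M = {u, y} \<or> M = {u, x, y}" using 2 sub by blast
      then consider "M = {u, x}" | "M = {u, y}" | "M = {u, x, y}" using M(3) by blast
      then show ?thesis
      proof cases
        case 1
        then have "twins c X u x" "c y u = c y x" using hom xy u unfolding twins_def by auto
        then show ?thesis using u by blast
      next
        case 2
        then have "twins c X u y" "c x u = c x y" using hom xy u unfolding twins_def by auto
        then show ?thesis using u by blast
      next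
        case 3
        then have "twins c X u x" "twins c X u y" using hom xy u unfolding twins_def by auto
        then show ?thesis using u by blast
      qed
    next
      case 3
      then have "M = X \<or> M = insert x X \<or> M = insert y X" using sub M(4) by blast
      then show ?thesis
      proof (elim disjE)
        assume "M = X"
        then have "uniform c X x \<and> uniform c X y" using hom xy unfolding uniform_def by blast
        then show ?thesis by blast
      next
        assume "M = insert x X"
        then have "uniform c (insert x X) y" using hom xy unfolding uniform_def by blast
        then show ?thesis by blast
      next
        assume "M = insert y X"
        then have "uniform c (insert y X) x" using hom xy unfolding uniform_def by blast
        then show ?thesis by blast
      qed
    qed
  qed
  have un_sub: "uniform c X v" if "uniform c (insert w X) v" for v w
    using that unfolding uniform_def by blast
  \<comment> \<open>Each uniform point sees \<open>X\<close> and all outside points that are not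
    uniform in one colour, so these together will form a homogeneous set. \<open>claim_twins\<close>
    prepares the same for a point \<open>u\<close> of \<open>X\<close> with its outside
    twins.\<close>
  have claim_uniform: "c x y = c x a"
    if xy: "x \<in> V - X" "y \<in> V - X" "uniform c X x" "\<not> uniform c X y" "a \<in> X" for x y a
  proof -
    have "x \<noteq> y" using xy by blast
    have 1: "\<not> twins c X x y"
    proof
      assume t: "twins c X x y"
      have "uniform c X y"
      proof (rule uniformI)
        fix v w assume vw: "v \<in> X" "w \<in> X" "v \<noteq> y" "w \<noteq> y"
        then have "v \<noteq> x" "w \<noteq> x" using xy by blast+
        then have "c x v = c y v" "c x w = c y w" "c x v = c x w"
          using twins_rev[OF t] uniformD[OF xy(3)] vw by blast+
        then show "c y v = c y w" by simp
      qed
      then show False using xy by blast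
    qed
    have 2: "\<not> twins c X u x" if "u \<in> X" for u using not_both xy that by blast
    have "(\<exists>u\<in>X. c x u = c x y) \<or> uniform c (insert y X) x"
      using pair[of x y] 1 2 un_sub xy \<open>x \<noteq> y\<close> by blast
    moreover have "c x u = c x a" if "u \<in> X" for u using that xy uniformD[OF xy(3)] by blast
    moreover have "c x y = c x a" if "uniform c (insert y X) x"
      by (rule uniformD[OF that]) (use xy \<open>x \<noteq> y\<close> in auto)
    ultimately show ?thesis by metis
  qed
  have claim_twins: "c y u = c y x"
    if xy: "x \<in> V - X" "y \<in> V - X" "u \<in> X" "twins c X u x" "\<not> twins c X u y" for x y u
  proof -
    have "x \<noteq> y" using xy by blast
    have 1: "\<not> twins c X x y"
    proof
      assume "twins c X x y"
      then have "twins c X u y" using xy unfolding twins_def by auto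
      then show False using xy by blast
    qed
    have 2: "u' = u" if "u' \<in> X" "twins c X u' x" for u' using tw_unique that xy by blast
    have 3: "\<not> uniform c X x" using not_both xy by blast
    consider "c y u = c y x" | u' where "u' \<in> X" "twins c X u' y" "c x u' = c x y" | "uniform c (insert x X) y"
      using pair[of x y] 1 2 3 un_sub xy \<open>x \<noteq> y\<close> by blast
    then show ?thesis
    proof cases
      \<comment> \<open>The colour moves along the pairs \<open>x y\<close>, \<open>x u'\<close>,
        \<open>u u'\<close>, \<open>u y\<close>, using in turn the choice of \<open>u'\<close>, that
        \<open>u\<close> and \<open>x\<close> are twins, and that \<open>u'\<close> and
        \<open>y\<close> are twins.\<close>
      case 2
      then have "u' \<noteq> u" using xy by blast
      have "c x y = c x u'" using 2 by simp
      also have "c x u' = c u u'"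
        by (rule twins_rev[OF xy(4), symmetric]) (use 2 xy \<open>u' \<noteq> u\<close> in auto)
      also have "c u u' = c u y"
        by (rule twinsD[OF 2(2)]) (use xy \<open>u' \<noteq> u\<close> in auto)
      finally have "c y x = c y u" by (rule col_rev[rotated 2]) (use xy \<open>x \<noteq> y\<close> in auto)
      then show ?thesis by simp
    next
      case 3
      show ?thesis by (rule uniformD[OF 3]) (use xy \<open>x \<noteq> y\<close> in auto)
    qed
  qed
  obtain a b where ab: "a \<in> X" "b \<in> X" "a \<noteq> b"
    using X(3) card_ge_2_obtain[of X] by auto
  have no_uniform: "\<not> uniform c X x" if "x \<in> V - X" for x
  proof
    assume "uniform c X x"
    let ?M = "{v \<in> V. v \<in> X \<or> \<not> uniform c X v}"
    have sees: "c v w = c v a" if "v \<in> V - ?M" "w \<in> ?M" for v w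
    proof (cases "w \<in> X")
      case True
      then show ?thesis using that ab uniformD[of c X v w a] by blast
    next
      case False
      then show ?thesis using that ab claim_uniform by blast
    qed
    have "homogeneous c V ?M" by (rule homogeneousI[of _ _ _ a], blast, rule sees)
    then have "?M = V" using prime_set_large[OF V, of ?M a b] ab X(2) by blast
    then show False using \<open>uniform c X x\<close> that by blast
  qed
  have no_twins: "\<not> twins c X u x" if "x \<in> V - X" "u \<in> X" for x u
  proof
    assume "twins c X u x"
    let ?M = "insert u {v \<in> V - X. twins c X u v}"
    have sees: "c v w = c v u" if "v \<in> V - ?M" "w \<in> ?M" for v w
    proof (cases "v \<in> X")
      case True
      show ?thesis
      proof (cases "w = u")
        case False
        then have "twins c X u w" "v \<noteq> w" "v \<noteq> u" using that True by blast+
        then show ?thesis using twinsD True by metis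
      qed simp
    next
      case False
      show ?thesis
      proof (cases "w = u")
        case w: False
        have "c v u = c v w"
          by (rule claim_twins) (use w that False \<open>u \<in> X\<close> in auto)
        then show ?thesis by simp
      qed simp
    qed
    have "homogeneous c V ?M"
      by (rule homogeneousI[of _ _ _ u], use X(2) that(2) in blast, rule sees)
    moreover have "u \<noteq> x" using that by blast
    ultimately have "?M = V"
      using prime_set_large[OF V, of ?M u x] that \<open>twins c X u x\<close> by blast
    moreover obtain w where "w \<in> X" "w \<noteq> u" using ab by metis
    ultimately show False using X(2) by blast
  qed
  \<comment> \<open>With no uniform point and no twin of a point of \<open>X\<close>, only the first
    disjunct of \<open>pair\<close> survives, so the complement of \<open>X\<close> is
    homogeneous.\<close>
  have all_twins: "twins c X x y" if "x \<in> V - X" "y \<in> V - X" for x y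
    using pair[of x y] no_uniform no_twins un_sub that by (cases "x = y") (simp add: twins_def, blast)
  have "c u y = c u x" if "x \<in> V - X" "y \<in> V - X" "u \<in> X" for x y u
    by (rule twinsD[OF all_twins, symmetric]) (use that in auto)
  then have "homogeneous c V (V - X)" unfolding homogeneous_def by blast
  moreover obtain x y where "x \<in> V - X" "y \<in> V - X" "x \<noteq> y"
    using two card_ge_2_obtain by blast
  ultimately have "V - X = V" using prime_set_large[OF V] by blast
  then show False using ab X(2) by blast
qed

lemma prime_set_extend_most:
  assumes "prime_set c V" "finite V" "prime_set c X" "X \<subset> V" "3 \<le> card X"
  shows "\<exists>Y. X \<subseteq> Y \<and> Y \<subset> V \<and> prime_set c Y \<and> card (V - Y) \<le> 2"
  using assms(3-5)
proof (induction "card (V - X)" arbitrary: X rule: less_induct)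
  case less
  show ?case
  proof (cases "card (V - X) \<le> 2")
    case True
    then show ?thesis using less.prems by blast
  next
    case False
    then obtain x y where xy: "x \<in> V - X" "y \<in> V - X" "x \<noteq> y" "prime_set c (insert x (insert y X))"
      using prime_set_extend_two[OF assms(1) less.prems(1)] less.prems(2,3) by auto
    let ?X = "insert x (insert y X)"
    have fin: "finite X" using less.prems(2) assms(2) finite_subset by blast
    have "V - X \<noteq> {x, y}" using False xy(3) by auto
    then have sub: "?X \<subset> V" using xy less.prems(2) by blast
    have "card (V - ?X) < card (V - X)"
      by (rule psubset_card_mono) (use assms(2) xy in auto)
    moreover have "3 \<le> card ?X" using less.prems(3) fin xy by simp
    ultimately obtain Y where "?X \<subseteq> Y \<and> Y \<subset> V \<and> prime_set c Y \<and> card (V - Y) \<le> 2"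
      using less.hyps[OF _ xy(4) sub] by blast
    then show ?thesis by blast
  qed
qed

end

section \<open>Prime sets without prime one-point deletions\<close>

text \<open>Index pairs in decreasing order are not listed because reversibility determines them.
  With \<open>A\<close> different from \<open>B\<close> and from the reverse of \<open>B\<close>,
  and with at least four points, these are critical structures in the sense of Schmerl and Trotter:
  prime, but without prime one-point deletions.\<close>

definition zigzag :: "('a \<Rightarrow> 'a \<Rightarrow> 'c) \<Rightarrow> nat \<Rightarrow> (nat \<Rightarrow> 'a) \<Rightarrow> 'c \<Rightarrow> 'c \<Rightarrow> bool" where
  "zigzag c m p A B \<longleftrightarrow> inj_on p {..<2 * m} \<and>
     (\<forall>j<2 * m. \<forall>i<j. c (p i) (p j) = (if even i \<and> odd j then A else B))"

context order_colouring
begin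

section \<open>The graph of deletable pairs\<close>

context
  fixes V X :: "'a set"
  assumes finV: "finite V" and primeV: "prime_set c V" and cardV: "5 \<le> card V"
    and no_good: "\<And>v. v \<in> V \<Longrightarrow> embeds c X c (V - {v}) \<Longrightarrow> \<not> prime_set c (V - {v})"
begin

text \<open>This is the indecomposability graph of \<open>V\<close>, restricted to the pairs whose
  removal leaves room for a copy of \<open>X\<close>.\<close>

definition edge :: "'a \<Rightarrow> 'a \<Rightarrow> bool" where
  "edge x y \<longleftrightarrow> x \<in> V \<and> y \<in> V \<and> x \<noteq> y \<and> prime_set c (V - {x, y}) \<and> embeds c X c (V - {x, y})"

lemma edge_sym: "edge x y \<longleftrightarrow> edge y x"
  unfolding edge_def by (auto simp: insert_commute)

text \<open>Sending \<open>z\<close> to \<open>y\<close> maps \<open>V - {x, y}\<close>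
  isomorphically onto \<open>V - {x, z}\<close>. A copy of \<open>X\<close> is carried to another
  copy, which is why \<open>embeds\<close> and not inclusion appears in \<open>edge\<close>.\<close>

lemma edge_swap:
  assumes "edge x y" "z \<in> V" "z \<noteq> x" "twins c (V - {x}) y z"
  shows "edge x z"
proof (cases "y = z")
  case False
  let ?h = "\<lambda>v. if v = z then y else v"
  have xy: "x \<in> V" "y \<in> V" "x \<noteq> y" "prime_set c (V - {x, y})" "embeds c X c (V - {x, y})"
    using assms(1) unfolding edge_def by auto
  have inj: "inj_on ?h (V - {x, y})" unfolding inj_on_def by auto
  have img: "?h ` (V - {x, y}) = V - {x, z}"
  proof
    show "V - {x, z} \<subseteq> ?h ` (V - {x, y})"
    proof
      fix v assume "v \<in> V - {x, z}"
      then show "v \<in> ?h ` (V - {x, y})"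
        using assms(2,3) False by (cases "v = y") (auto simp: image_iff)
    qed
  qed (use xy False in auto)
  have col: "c (?h a) (?h b) = c a b" if "a \<in> V - {x, y}" "b \<in> V - {x, y}" "a \<noteq> b" for a b
  proof -
    have "c y b = c z b" if "b \<noteq> z" by (rule twins_rev[OF assms(4)]) (use that \<open>b \<in> _\<close> in auto)
    moreover have "c a y = c a z" if "a \<noteq> z" by (rule twinsD[OF assms(4)]) (use that \<open>a \<in> _\<close> in auto)
    moreover have "a \<noteq> y" "b \<noteq> y" using that by auto
    ultimately show ?thesis using that(3) by (cases "a = z"; cases "b = z") simp_all
  qed
  have "prime_set c (V - {x, z})"
    using prime_set_image[OF inj col xy(4)] img by simp
  moreover have "embeds c (V - {x, y}) c (V - {x, z})"
    unfolding embeds_def using inj img col by (intro exI[of _ ?h]) blast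
  then have "embeds c X c (V - {x, z})" using xy(5) embeds_trans by blast
  ultimately show ?thesis using assms(2,3) xy unfolding edge_def by auto
qed (use assms in auto)

text \<open>The bound 5 on \<open>V\<close> serves here: after the removal of a pair, three points
  remain, enough to exclude twins and uniform points.\<close>

lemma edge_card: "edge x y \<Longrightarrow> 3 \<le> card (V - {x, y})"
  using finV cardV unfolding edge_def by simp

text \<open>\<open>V - {x}\<close> contains a copy of \<open>X\<close> and so is not prime, but it
  is only one point larger than the prime set \<open>V - {x, y}\<close>; that point \<open>y\<close>
  must carry the defect.\<close>

lemma edge_cases:
  assumes "edge x y"
  shows "uniform c (V - {x}) y \<or> (\<exists>z\<in>V - {x, y}. twins c (V - {x}) y z)"
proof -
  have xy: "x \<in> V" "y \<in> V" "x \<noteq> y" "prime_set c (V - {x, y})" "embeds c X c (V - {x, y})"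
    using assms unfolding edge_def by auto
  have "embeds c X c (V - {x})" by (rule embeds_mono[OF xy(5)]) auto
  then have "\<not> prime_set c (V - {x})" using no_good xy(1) by blast
  then obtain M where M: "homogeneous c (V - {x}) M" "M \<noteq> {}" "\<not> (\<exists>a. M = {a})" "M \<noteq> V - {x}"
    unfolding prime_set_def by blast
  have sub: "M \<subseteq> V - {x}" and hom: "\<And>v a b. v \<in> V - {x} - M \<Longrightarrow> a \<in> M \<Longrightarrow> b \<in> M \<Longrightarrow> c v a = c v b"
    using M(1) unfolding homogeneous_def by blast+
  have "M \<inter> (V - {x, y}) = {} \<or> (\<exists>z. M \<inter> (V - {x, y}) = {z}) \<or> V - {x, y} \<subseteq> M"
    by (rule prime_set_Int[OF xy(4) M(1)]) auto
  then consider "M \<inter> (V - {x, y}) = {}" | z where "M \<inter> (V - {x, y}) = {z}" | "V - {x, y} \<subseteq> M" by blast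
  then show ?thesis
  proof cases
    case 1
    then have "M \<subseteq> {y}" using sub by blast
    then show ?thesis using M(2,3) by blast
  next
    case 2
    then have z: "z \<in> V - {x, y}" "z \<in> M" by blast+
    have "M \<subseteq> {y, z}" using 2 sub by blast
    then have "M = {y, z}" using M(3) z by blast
    then have "twins c (V - {x}) y z" using hom unfolding twins_def by blast
    then show ?thesis using z by blast
  next
    case 3
    then have "M = V - {x, y}" using sub M(4) xy by blast
    then have "uniform c (V - {x}) y" using hom xy unfolding uniform_def by blast
    then show ?thesis by blast
  qed
qed

text \<open>Inside the prime set \<open>V - {x, z}\<close> the point \<open>y\<close> is neither
  uniform nor a twin of another point, so the defect given by \<open>edge_cases\<close> must involve
  \<open>z\<close>.\<close>

lemma edge_twins:
  assumes "edge x y" "edge x z" "y \<noteq> z"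
  shows "twins c (V - {x}) y z"
proof -
  have xy: "x \<in> V" "y \<in> V" "z \<in> V" "x \<noteq> y" "x \<noteq> z" and prime: "prime_set c (V - {x, z})"
    using assms unfolding edge_def by auto
  have "\<not> uniform c (V - {x, z}) y"
    by (rule prime_set_not_uniform[OF prime _ edge_card[OF assms(2)]]) (use xy assms(3) in auto)
  moreover have "\<not> twins c (V - {x, z}) y w" if "w \<in> V - {x, y}" "w \<noteq> z" for w
    by (rule prime_set_not_twins[OF prime _ _ _ edge_card[OF assms(2)]]) (use xy assms(3) that in auto)
  ultimately show ?thesis
    using edge_cases[OF assms(1)] unfolding uniform_def twins_def by blast
qed

text \<open>Any two neighbours of \<open>x\<close> are twins over \<open>V - {x}\<close>; removing a
  third neighbour would leave twins in a prime set. Hence the components of the graph are paths and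
  cycles.\<close>

lemma edge_degree:
  assumes "edge x y1" "edge x y2" "edge x y3" "y1 \<noteq> y2" "y1 \<noteq> y3" "y2 \<noteq> y3"
  shows False
proof -
  have "twins c (V - {x}) y1 y2" using edge_twins assms by blast
  then have "twins c (V - {x, y3}) y1 y2" unfolding twins_def by blast
  moreover have "y1 \<in> V - {x, y3}" "y2 \<in> V - {x, y3}" "prime_set c (V - {x, y3})"
    using assms unfolding edge_def by auto
  ultimately show False using prime_set_not_twins edge_card[OF assms(3)] assms(4) by metis
qed

text \<open>
  The two parity classes of an even cycle are homogeneous, an odd cycle is all of the set and
  would be a cycle in one of the two linear orders.
\<close>

lemma no_edge_cycle:
  assumes k: "3 \<le> k" and inj: "\<And>i j. q i = q j \<longleftrightarrow> i mod k = j mod k" and edges: "\<And>i. edge (q i) (q (Suc i))"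
  shows False
proof -
  have qV: "q i \<in> V" for i using edges unfolding edge_def by blast
  have neq: "q i \<noteq> q (i + d)" if "0 < d" "d < k" for i d
  proof
    assume "q i = q (i + d)"
    then have "k dvd d" using inj by (metis add_diff_cancel_left' le_add1 mod_eq_dvd_iff_nat)
    then show False using that by (simp add: nat_dvd_not_less)
  qed
  have tw: "twins c (V - {q (Suc i)}) (q i) (q (Suc (Suc i)))" for i
    by (rule edge_twins) (use edges edge_sym neq[of 2 i] k in auto)
  have mod: "q i = q (i mod k)" for i using inj by simp
  show False
  proof (cases "even k")
    case True
    \<comment> \<open>Moving the second point two places on changes nothing as long as the point
      jumped over is not \<open>q j\<close> itself, and within one round it is not.\<close>
    have far: "c (q j) (q (j + 1)) = c (q j) (q (j + 2 * d + 1))" if "2 * d + 1 < k" for j d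
      using that
    proof (induction d)
      case (Suc d)
      have "c (q j) (q (j + 2 * d + 1)) = c (q j) (q (Suc (Suc (j + 2 * d + 1))))"
        by (rule twinsD[OF tw])
          (use neq[of "Suc (2 * d)" j] neq[of "Suc (Suc (2 * d))" j] neq[of "Suc (Suc (Suc (2 * d)))" j]
              Suc.prems qV in auto)
      then show ?case using Suc by simp
    qed simp
    let ?O = "{q i | i. odd i}"
    have sees: "c v a = c v (q 1)" if v: "v \<in> V - ?O" and a: "a \<in> ?O" for v a
    proof (cases "v \<in> range q")
      case True
      then obtain j where j: "v = q j" by blast
      then have "even j" using v by blast
      have same: "c v (q i) = c v (q (j + 1))" if "odd i" for i
      proof -
        \<comment> \<open>\<open>e\<close> is the distance from \<open>j\<close> forward to
          \<open>i\<close> around the cycle; it is odd because \<open>k\<close> is even, so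
          \<open>far\<close> applies.\<close>
        define e where "e = (i + (k - j mod k)) mod k"
        have "(j + e) mod k = (j mod k + (i + (k - j mod k))) mod k"
          unfolding e_def by (simp add: mod_simps)
        also have "j mod k + (i + (k - j mod k)) = i + k"
          using k mod_less_divisor[of k j] by linarith
        finally have "q (j + e) = q i" using inj by simp
        have "even (j mod k)" using \<open>even j\<close> \<open>even k\<close> by (simp add: dvd_mod_iff)
        then have "even (k - j mod k)" using \<open>even k\<close> by (rule dvd_diff_nat[rotated])
        then have "odd (i + (k - j mod k))" using that by simp
        then have "odd e" unfolding e_def using \<open>even k\<close> by (simp add: dvd_mod_iff)
        then obtain d where d: "e = 2 * d + 1" by (rule oddE)
        have "e < k" unfolding e_def using k by simp
        then show ?thesis using far[of d j] d \<open>q (j + e) = q i\<close> j by (simp add: add.assoc)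
      qed
      show ?thesis using a same by force
    next
      case False
      have "c v (q i) = c v (q (Suc (Suc i)))" for i
        by (rule twinsD[OF tw]) (use False v in auto)
      then have "c v (q (2 * d + 1)) = c v (q 1)" for d by (induction d) auto
      then show ?thesis using a by (auto elim!: oddE)
    qed
    have "homogeneous c V ?O" by (rule homogeneousI[of _ _ _ "q 1"], use qV in blast, rule sees)
    moreover have "q 1 \<in> ?O" "q 3 \<in> ?O" using odd_one by (blast, force)
    moreover have "q 1 \<noteq> q 3"
      using neq[of 2 1] k by (simp add: eval_nat_numeral)
    ultimately have "?O = V" using prime_set_large[OF primeV] by blast
    then have "q 0 \<in> ?O" using qV by blast
    then obtain i where "q 0 = q i" "odd i" by blast
    then have "0 mod k = i mod k" using inj by blast
    then show False using \<open>even k\<close> \<open>odd i\<close> by (auto dest: dvd_trans)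
  next
    case False
    have per: "q (i + k) = q i" for i using inj by simp
    \<comment> \<open>For odd \<open>k\<close> the number \<open>k + 1\<close> is even, so steps of
      length two also lead from a point to the next one, hence to all points of the cycle.\<close>
    have step_all: "P" if step: "\<And>i. f (q (Suc (Suc i))) = f (q i)" and P: "(\<And>i. f (q i) = f (q 0)) \<Longrightarrow> P"
      for f :: "'a \<Rightarrow> 'c" and P
    proof (rule P)
      have even_steps: "f (q (i + 2 * d)) = f (q i)" for i d by (induction d) (auto simp: step)
      have "f (q (Suc i)) = f (q i)" for i
      proof -
        obtain d where d: "Suc k = 2 * d" using False by (metis evenE even_Suc)
        have "f (q (i + Suc k)) = f (q i)" using even_steps[of i d] d by simp
        then show ?thesis using per[of "Suc i"] by simp
      qed
      then show "f (q i) = f (q 0)" for i by (induction i) auto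
    qed
    have sees: "c v a = c v (q 0)" if "v \<in> V - range q" "a \<in> range q" for v a
    proof -
      have "c v (q (Suc (Suc i))) = c v (q i)" for i
        by (rule twinsD[OF tw, symmetric]) (use that in auto)
      from step_all[of "c v", OF this] show ?thesis using that(2) by blast
    qed
    have "homogeneous c V (range q)" by (rule homogeneousI[of _ _ _ "q 0"], use qV in blast, rule sees)
    moreover have "q 0 \<noteq> q 1" using neq[of 1 0] k by simp
    ultimately have "range q = V" using prime_set_large[OF primeV, of "range q" "q 0" "q 1"] by blast
    moreover have "range q = q ` {..<k}"
    proof
      show "range q \<subseteq> q ` {..<k}"
      proof
        fix v assume "v \<in> range q"
        then obtain i where "v = q (i mod k)" using mod by blast
        then show "v \<in> q ` {..<k}" using k by auto
      qed
    qed auto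
    ultimately have "card V \<le> k" by (metis card_image_le card_lessThan finite_lessThan)
    then have k5: "5 \<le> k" using cardV by simp
    \<comment> \<open>The twins with indices \<open>i + 1\<close>, \<open>i + 3\<close> and then
      those with indices \<open>i\<close>, \<open>i + 2\<close> move an edge two places along the
      cycle; \<open>k5\<close> keeps the four points distinct.\<close>
    have step: "c (q (Suc (Suc i))) (q (Suc (Suc (Suc i)))) = c (q i) (q (Suc i))" for i
    proof -
      have ne: "q i \<noteq> q (i + 1)" "q i \<noteq> q (i + 2)" "q i \<noteq> q (i + 3)"
        "q (i + 1) \<noteq> q (i + 3)" "q (i + 2) \<noteq> q (i + 3)"
        using neq[of 1 i] neq[of 2 i] neq[of 3 i] neq[of 2 "i + 1"] neq[of 1 "i + 2"] k5
        by (auto simp: numeral_eq_Suc)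
      have "c (q i) (q (Suc i)) = c (q i) (q (Suc (Suc (Suc i))))"
        by (rule twinsD[OF tw]) (use ne qV in \<open>auto simp: numeral_eq_Suc\<close>)
      also have "\<dots> = c (q (Suc (Suc i))) (q (Suc (Suc (Suc i))))"
        by (rule twins_rev[OF tw]) (use ne qV in \<open>auto simp: numeral_eq_Suc\<close>)
      finally show ?thesis by simp
    qed
    define s where "s = c (q 0) (q 1)"
    have even_steps: "c (q (i + 2 * d)) (q (Suc (i + 2 * d))) = c (q i) (q (Suc i))" for i d
      by (induction d) (auto simp: step)
    have "c (q (Suc i)) (q (Suc (Suc i))) = c (q i) (q (Suc i))" for i
    proof -
      obtain d where d: "Suc k = 2 * d" using False by (metis evenE even_Suc)
      have "c (q (i + Suc k)) (q (Suc (i + Suc k))) = c (q i) (q (Suc i))" using even_steps[of i d] d by simp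
      then show ?thesis using per[of "Suc i"] per[of "Suc (Suc i)"] by simp
    qed
    then have s: "c (q i) (q (Suc i)) = s" for i unfolding s_def by (induction i) auto
    have "c (q 0) (q (Suc i)) = s" if "Suc i < k" for i
      using that
    proof (induction i)
      case (Suc i)
      have "q 0 \<noteq> q (Suc i)" using neq[of "Suc i" 0] Suc.prems by simp
      moreover have "q (Suc i) \<noteq> q (Suc (Suc i))" using neq[of 1 "Suc i"] k by simp
      moreover have "c (q 0) (q (Suc i)) = s" using Suc by simp
      ultimately show ?case using s by (rule col_trans)
    qed (use s in auto)
    from this[of "k - 2"] have "c (q 0) (q (k - 1)) = s" using k by (simp add: numeral_eq_Suc Suc_diff_Suc)
    moreover have "c (q (k - 1)) (q 0) = s" using s[of "k - 1"] per[of 0] k by simp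
    moreover have "q 0 \<noteq> q (k - 1)" using neq[of "k - 1" 0] k by simp
    ultimately show False using col_asym by metis
  qed
qed

section \<open>Maximal paths of deletable pairs\<close>

definition edge_path :: "'a list \<Rightarrow> bool" where
  "edge_path ps \<longleftrightarrow> distinct ps \<and> 2 \<le> length ps \<and> (\<forall>i. Suc i < length ps \<longrightarrow> edge (ps ! i) (ps ! Suc i))"

lemma edge_path_subset:
  assumes "edge_path ps"
  shows "set ps \<subseteq> V"
proof
  fix v assume "v \<in> set ps"
  then obtain i where i: "i < length ps" "v = ps ! i" by (auto simp: in_set_conv_nth)
  show "v \<in> V"
  proof (cases "Suc i < length ps")
    case True
    then show ?thesis using assms i unfolding edge_path_def edge_def by blast
  next
    case False
    then have "Suc (i - 1) < length ps" "v = ps ! Suc (i - 1)"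
      using assms i unfolding edge_path_def by auto
    then show ?thesis using assms unfolding edge_path_def edge_def by blast
  qed
qed

lemma edge_path_rev:
  assumes "edge_path ps"
  shows "edge_path (rev ps)"
  unfolding edge_path_def
proof (intro conjI allI impI)
  fix i assume i: "Suc i < length (rev ps)"
  let ?j = "length ps - Suc (Suc i)"
  have "edge (ps ! ?j) (ps ! Suc ?j)" using assms i unfolding edge_path_def by auto
  moreover have "rev ps ! i = ps ! Suc ?j" "rev ps ! Suc i = ps ! ?j"
    using i by (auto simp: rev_nth Suc_diff_Suc)
  ultimately show "edge (rev ps ! i) (rev ps ! Suc i)" using edge_sym by simp
qed (use assms in \<open>auto simp: edge_path_def\<close>)

text \<open>If the last point but one is not uniform, it has a twin \<open>z\<close>, and
  \<open>z\<close> is a further neighbour of the end. A new \<open>z\<close> prolongs the path, an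
  inner point of the path would get three neighbours, and the first point closes a cycle.\<close>

lemma edge_path_end:
  assumes path: "edge_path ps" and maximal: "\<And>z. \<not> edge_path (ps @ [z])"
  shows "uniform c (V - {ps ! (length ps - 1)}) (ps ! (length ps - 2))"
proof (rule ccontr)
  define k where "k = length ps"
  define x where "x = ps ! (k - 1)"
  define y where "y = ps ! (k - 2)"
  assume "\<not> ?thesis"
  then have not_uniform: "\<not> uniform c (V - {x}) y" unfolding x_def y_def k_def .
  have k: "2 \<le> k" and dist: "distinct ps" and edges: "\<And>i. Suc i < k \<Longrightarrow> edge (ps ! i) (ps ! Suc i)"
    using path unfolding edge_path_def k_def by auto
  have "Suc (k - 2) = k - 1" using k by simp
  then have "edge x y" using edges[of "k - 2"] edge_sym k unfolding x_def y_def by simp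
  then obtain z where z: "z \<in> V - {x, y}" "twins c (V - {x}) y z"
    using edge_cases not_uniform by blast
  have "edge x z" by (rule edge_swap[OF \<open>edge x y\<close> _ _ z(2)]) (use z in auto)
  show False
  proof (cases "z \<in> set ps")
    case False
    have "edge ((ps @ [z]) ! i) ((ps @ [z]) ! Suc i)" if "Suc i < length (ps @ [z])" for i
    proof (cases "Suc i < k")
      case True
      then show ?thesis using edges unfolding k_def by (simp add: nth_append)
    next
      case False
      then have "i = k - 1" "Suc i = k" using that unfolding k_def by simp_all
      then have "(ps @ [z]) ! i = x" "(ps @ [z]) ! Suc i = z"
        unfolding k_def x_def by (auto simp: nth_append)
      then show ?thesis using \<open>edge x z\<close> by simp
    qed
    then have "edge_path (ps @ [z])" using path False unfolding edge_path_def by simp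
    then show False using maximal by blast
  next
    case True
    then obtain i where i: "i < k" "z = ps ! i" unfolding k_def by (auto simp: in_set_conv_nth)
    have "i \<noteq> k - 1" "i \<noteq> k - 2" using i z unfolding x_def y_def by auto
    then have i2: "Suc (Suc i) < k" using i by linarith
    show False
    proof (cases i)
      case 0
      define q where "q n = ps ! (n mod k)" for n
      have k3: "3 \<le> k" using i2 by simp
      have "edge (q n) (q (Suc n))" for n
      proof (cases "Suc (n mod k) = k")
        case True
        then have "n mod k = k - 1" "Suc n mod k = 0" by (simp_all add: mod_Suc)
        then have "q n = x" "q (Suc n) = z" unfolding q_def x_def using i 0 by simp_all
        then show ?thesis using \<open>edge x z\<close> by simp
      next
        case False
        moreover have "n mod k < k" using k by simp
        ultimately show ?thesis using edges[of "n mod k"] unfolding q_def by (simp add: mod_Suc)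
      qed
      moreover have "q n = q n' \<longleftrightarrow> n mod k = n' mod k" for n n'
      proof -
        have "n mod k < length ps" "n' mod k < length ps" using k unfolding k_def[symmetric] by auto
        then show ?thesis unfolding q_def using dist nth_eq_iff_index_eq by blast
      qed
      ultimately show False using no_edge_cycle[OF k3] by blast
    next
      case (Suc j)
      have e: "edge z (ps ! j)" "edge z (ps ! Suc i)" "edge z x"
        using edges[of j] edges[of i] i i2 Suc edge_sym \<open>edge x z\<close> by auto
      have "ps ! j \<noteq> ps ! Suc i" "ps ! j \<noteq> x" "ps ! Suc i \<noteq> x"
        unfolding x_def using dist i2 Suc k_def by (auto simp: nth_eq_iff_index_eq)
      then show False using edge_degree[OF e] by blast
    qed
  qed
qed

text \<open>The two ends fix the colours seen from \<open>p 1\<close> and \<open>p (k - 2)\<close>,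
  and the twins along the path spread them two indices at a time, so that only parities matter.
  Transitivity excludes points off a path of even length, and then paths of odd length.\<close>

lemma edge_path_zigzag:
  assumes path: "edge_path ps"
    and first: "uniform c (V - {ps ! 0}) (ps ! 1)"
    and last: "uniform c (V - {ps ! (length ps - 1)}) (ps ! (length ps - 2))"
  shows "\<exists>m p A B. V = p ` {..<2 * m} \<and> zigzag c m p A B \<and> A \<noteq> B \<and> c (p 1) (p 0) \<noteq> B"
proof -
  define k where "k = length ps"
  define p where "p = (!) ps"
  have k: "2 \<le> k" and dist: "distinct ps" and edges: "\<And>i. Suc i < k \<Longrightarrow> edge (p i) (p (Suc i))"
    using path unfolding edge_path_def k_def p_def by auto
  have C: "set ps = p ` {..<k}" unfolding p_def k_def by (auto simp: in_set_conv_nth image_iff)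
  have pV: "p i \<in> V" if "i < k" for i using edge_path_subset[OF path] C that by blast
  have inj: "p i = p j \<longleftrightarrow> i = j" if "i < k" "j < k" for i j
    unfolding p_def using dist that k_def nth_eq_iff_index_eq by blast
  have U1: "c (p 1) v = c (p 1) w" if "v \<in> V" "w \<in> V" "v \<notin> {p 0, p 1}" "w \<notin> {p 0, p 1}" for v w
    using that uniformD[OF first] unfolding p_def by simp
  have U2: "c (p (k - 2)) v = c (p (k - 2)) w"
    if "v \<in> V" "w \<in> V" "v \<notin> {p (k - 1), p (k - 2)}" "w \<notin> {p (k - 1), p (k - 2)}" for v w
    using that uniformD[OF last] unfolding p_def k_def by simp
  have card3: "3 \<le> card V" using cardV by simp
  have nu: "\<not> uniform c V (p i)" if "i < k" for i
    by (rule prime_set_not_uniform[OF primeV pV[OF that] card3])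
  have const: "False" if "i < k" "\<And>v. v \<in> V \<Longrightarrow> v \<noteq> p i \<Longrightarrow> c (p i) v = s" for i s
  proof -
    have "uniform c V (p i)" by (rule uniformI) (simp add: that(2))
    then show False using nu that(1) by blast
  qed
  \<comment> \<open>Points two places apart are twins except for the point between them, so
    \<open>v\<close> has to avoid the whole stretch.\<close>
  have shift: "c v (p i) = c v (p (i + 2 * d))"
    if "v \<in> V" "i + 2 * d < k" "\<And>j. i \<le> j \<Longrightarrow> j \<le> i + 2 * d \<Longrightarrow> v \<noteq> p j" for v i d
    using that(2,3)
  proof (induction d)
    case (Suc d)
    let ?j = "i + 2 * d"
    have "edge (p ?j) (p (Suc ?j))" "edge (p (Suc ?j)) (p (Suc (Suc ?j)))"
      using Suc.prems(1) by (auto intro!: edges)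
    moreover have "p ?j \<noteq> p (Suc (Suc ?j))" using inj Suc.prems(1) by simp
    ultimately have "twins c (V - {p (Suc ?j)}) (p ?j) (p (Suc (Suc ?j)))"
      using edge_twins edge_sym by blast
    moreover have "v \<noteq> p ?j" "v \<noteq> p (Suc ?j)" "v \<noteq> p (Suc (Suc ?j))" using Suc.prems(2) by auto
    ultimately have "c v (p ?j) = c v (p (Suc (Suc ?j)))" using that(1) unfolding twins_def by blast
    then show ?case using Suc by simp
  qed simp
  have shift': "c v (p i) = c v (p j)"
    if "v \<in> V" "i \<le> j" "j < k" "even i = even j" "\<And>l. i \<le> l \<Longrightarrow> l \<le> j \<Longrightarrow> v \<noteq> p l" for v i j
  proof -
    have "even (j - i)" using that by simp
    then obtain d where "j - i = 2 * d" by (rule evenE)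
    then have "j = i + 2 * d" using that by simp
    then show ?thesis using shift that by blast
  qed
  \<comment> \<open>For \<open>k = 2\<close> both points of the path are uniform over the rest,
    which is therefore homogeneous. For \<open>k = 3\<close> the middle point is uniform from both
    ends, and a point \<open>w\<close> off the path links the two colours, so it is uniform over all
    of \<open>V\<close>.\<close>
  have k4: "4 \<le> k"
  proof (rule ccontr)
    assume "\<not> 4 \<le> k"
    have "card (set ps) < card V"
      using \<open>\<not> 4 \<le> k\<close> cardV card_length[of ps] unfolding k_def by linarith
    consider "k = 2" | "k = 3" using k \<open>\<not> 4 \<le> k\<close> by linarith
    then show False
    proof cases
      case 1
      let ?W = "V - {p 0, p 1}"
      have "c v a = c v b" if "v \<in> V - ?W" "a \<in> ?W" "b \<in> ?W" for v a b
        using that U1[of a b] U2[of a b] 1 by auto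
      then have hom: "homogeneous c V ?W" unfolding homogeneous_def by blast
      have "2 \<le> card ?W" using finV cardV pV inj[of 0 1] 1 by simp
      then obtain a b where "a \<in> ?W" "b \<in> ?W" "a \<noteq> b" by (rule card_ge_2_obtain)
      then have "?W = V" using prime_set_large[OF primeV hom] by blast
      then show False using pV[of 0] 1 by auto
    next
      case 2
      obtain w where w: "w \<in> V" "w \<notin> set ps"
        using \<open>card (set ps) < card V\<close> finite_set[of ps] by (meson card_mono not_le subsetI)
      then have w': "w \<noteq> p 0" "w \<noteq> p 1" "w \<noteq> p 2" using C 2 by auto
      have "c (p 1) v = c (p 1) w" if "v \<in> V" "v \<noteq> p 1" for v
        using U1[of v w] U2[of v w] that w w' inj[of 0 2] 2 by (cases "v = p 0") (auto simp: numeral_eq_Suc)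
      then show False by (rule const[of 1, rotated]) (use 2 in auto)
    qed
  qed
  \<comment> \<open>\<open>s\<close> is the colour in which \<open>p 1\<close> sees everything but
    \<open>p 0\<close>. Its reverse \<open>s'\<close> is the colour in which
    \<open>p (k - 2)\<close> sees everything but \<open>p (k - 1)\<close>.\<close>
  define s where "s = c (p 1) (p (k - 2))"
  define s' where "s' = c (p (k - 2)) (p 1)"
  have s: "c (p 1) v = s" if "v \<in> V" "v \<noteq> p 0" "v \<noteq> p 1" for v
    unfolding s_def using that k4 inj pV by (intro U1) auto
  have s': "c (p (k - 2)) v = s'" if "v \<in> V" "v \<noteq> p (k - 1)" "v \<noteq> p (k - 2)" for v
    unfolding s'_def using that k4 inj pV by (intro U2) auto
  have ss': "s \<noteq> s'" unfolding s_def s'_def by (rule col_asym) (use inj k4 in auto)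
  have rs: "c v (p (k - 2)) = s" if "v \<in> V" "v \<noteq> p (k - 1)" "v \<noteq> p (k - 2)" for v
    unfolding s_def
    by (rule col_rev[of "p (k - 2)" v "p (k - 2)" "p 1"]) (use that s' s'_def inj k4 in auto)
  have p10: "c (p 1) (p 0) \<noteq> s"
  proof
    assume "c (p 1) (p 0) = s"
    then have "c (p 1) v = s" if "v \<in> V" "v \<noteq> p 1" for v using s that by blast
    then show False by (rule const[of 1, rotated]) (use k in auto)
  qed
  have "V \<subseteq> set ps"
  proof
    fix w assume "w \<in> V"
    show "w \<in> set ps"
    proof (rule ccontr)
      assume "w \<notin> set ps"
      then have w: "w \<noteq> p i" if "i < k" for i using C that by blast
      have ws: "c (p 1) w = s" "c (p (k - 2)) w = s'" "c w (p (k - 2)) = s"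
        using s s' rs w \<open>w \<in> V\<close> k4 by auto
      \<comment> \<open>For even \<open>k\<close> the shift runs from \<open>p 0\<close> to
        \<open>p (k - 2)\<close>, and passing through \<open>w\<close> the pair \<open>p 1\<close>,
        \<open>p 0\<close> gets colour \<open>s\<close>; for odd \<open>k\<close> it runs from
        \<open>p 1\<close>, which forces \<open>s = s'\<close>.\<close>
      show False
      proof (cases "even k")
        case True
        have "c w (p 0) = c w (p (k - 2))" by (rule shift') (use True k4 w \<open>w \<in> V\<close> in auto)
        then have "c w (p 0) = s" using ws by simp
        have "c (p 1) (p 0) = s"
          by (rule col_trans[OF _ _ ws(1) \<open>c w (p 0) = s\<close>]) (use w[of 1] w[of 0] k4 in auto)
        then show False using p10 by blast
      next
        case False
        have "c w (p 1) = c w (p (k - 2))" by (rule shift') (use False k4 w \<open>w \<in> V\<close> in auto)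
        then have "c (p 1) w = c (p (k - 2)) w"
          by (rule col_rev[rotated 2]) (use w[of 1] w[of "k - 2"] k4 in auto)
        then show False using ws ss' by simp
      qed
    qed
  qed
  then have V: "V = p ` {..<k}" using edge_path_subset[OF path] C by blast
  have odd_s: "c (p i) (p j) = s" if "i < j" "j < k" "odd i" for i j
  proof -
    have "c (p j) (p 1) = c (p j) (p i)"
      by (rule shift') (use that inj pV in \<open>auto simp: Suc_le_eq odd_pos\<close>)
    then have "c (p 1) (p j) = c (p i) (p j)"
      by (rule col_rev[rotated 2]) (use that inj in \<open>auto simp: odd_pos\<close>)
    moreover have "1 < j" using that odd_pos[of i] by linarith
    then have "c (p 1) (p j) = s" by (intro s) (use that inj pV in auto)
    ultimately show ?thesis by simp
  qed
  have even_s: "c (p i) (p j) = s" if "i < j" "j \<le> k - 2" "even i" "even j = even k" for i j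
  proof -
    have "c (p i) (p j) = c (p i) (p (k - 2))"
      by (rule shift') (use that k4 inj pV in auto)
    then show ?thesis using rs[of "p i"] that k4 inj pV by auto
  qed
  \<comment> \<open>For odd \<open>k\<close> all adjacent pairs have colour \<open>s\<close>, so by
    transitivity \<open>p 0\<close> would be uniform.\<close>
  have "even k"
  proof (rule ccontr)
    assume "odd k"
    have adj: "c (p i) (p (Suc i)) = s" if "Suc i < k" for i
    proof (cases "odd i")
      case True
      then show ?thesis using odd_s that by blast
    next
      case False
      then have "Suc i \<noteq> k - 1" using \<open>odd k\<close> that by (metis Suc_diff_1 even_Suc less_zeroE not_gr_zero)
      then show ?thesis by (intro even_s) (use that False \<open>odd k\<close> in auto)
    qed
    have "c (p 0) (p (Suc i)) = s" if "Suc i < k" for i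
      using that
    proof (induction i)
      case (Suc i)
      have "p 0 \<noteq> p (Suc i)" "p (Suc i) \<noteq> p (Suc (Suc i))" using inj Suc.prems by auto
      moreover have "c (p 0) (p (Suc i)) = s" using Suc by simp
      ultimately show ?case using adj[OF Suc.prems] by (rule col_trans)
    qed (use adj in auto)
    then have "c (p 0) v = s" if "v \<in> V" "v \<noteq> p 0" for v
      using that V by (metis imageE lessThan_iff not0_implies_Suc)
    then show False by (rule const[of 0, rotated]) (use k in auto)
  qed
  then obtain m where m: "k = 2 * m" by (rule evenE)
  \<comment> \<open>The pairs still open lead from an even to a later odd index; shifting both
    indices outwards reduces them all to the extreme pair.\<close>
  define t where "t = c (p 0) (p (k - 1))"
  have even_t: "c (p i) (p j) = t" if "i < j" "j < k" "even i" "odd j" for i j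
  proof -
    have "c (p i) (p j) = c (p i) (p (k - 1))"
      by (rule shift') (use that \<open>even k\<close> inj pV in auto)
    also have "c (p (k - 1)) (p 0) = c (p (k - 1)) (p i)"
      by (rule shift') (use that \<open>even k\<close> inj pV in auto)
    then have "c (p 0) (p (k - 1)) = c (p i) (p (k - 1))"
      by (rule col_rev[rotated 2]) (use that inj in auto)
    then have "c (p i) (p (k - 1)) = t" unfolding t_def by simp
    finally show ?thesis .
  qed
  have "zigzag c m p t s"
    unfolding zigzag_def m[symmetric]
  proof (intro conjI allI impI)
    show "inj_on p {..<k}" using inj by (auto simp: inj_on_def)
    fix i j assume "j < k" "i < j"
    then show "c (p i) (p j) = (if even i \<and> odd j then t else s)"
    proof (cases "odd i \<or> odd j")
      case False
      then have "j \<noteq> k - 1" using \<open>even k\<close> \<open>j < k\<close> k by auto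
      then show ?thesis using False even_s[of i j] \<open>i < j\<close> \<open>j < k\<close> \<open>even k\<close> by auto
    qed (use odd_s even_t in auto)
  qed
  moreover have "t \<noteq> s"
  proof
    assume "t = s"
    then have "c (p 0) (p j) = s" if "0 < j" "j < k" for j
      using calculation that unfolding zigzag_def m by auto
    then have "c (p 0) v = s" if "v \<in> V" "v \<noteq> p 0" for v
      using that V by (metis imageE lessThan_iff not_gr_zero)
    then show False by (rule const[of 0, rotated]) (use k in auto)
  qed
  ultimately show ?thesis using V m p10 by blast
qed

lemma delete_edge_zigzag:
  assumes "x \<in> V" "y \<in> V" "x \<noteq> y" "prime_set c (V - {x, y})" "embeds c X c (V - {x, y})"
  shows "\<exists>m p A B. V = p ` {..<2 * m} \<and> zigzag c m p A B \<and> A \<noteq> B \<and> c (p 1) (p 0) \<noteq> B"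
proof -
  have "edge x y" using assms unfolding edge_def by blast
  then have "edge_path [x, y]" unfolding edge_path_def using assms(3) by (auto simp: less_Suc_eq)
  have bound: "length ps \<le> card V" if "edge_path ps" for ps
  proof -
    have "distinct ps" using that unfolding edge_path_def by blast
    then show ?thesis
      using card_mono[OF finV edge_path_subset[OF that]] distinct_card[of ps] by simp
  qed
  \<comment> \<open>A longest path cannot be prolonged at either end, so
    \<open>edge_path_end\<close> applies to it and to its reverse.\<close>
  obtain ps where ps: "edge_path ps" "\<And>qs. edge_path qs \<Longrightarrow> length qs \<le> length ps"
    using ex_has_greatest_nat[of "edge_path" "[x, y]" length "Suc (card V)"]
      \<open>edge_path [x, y]\<close> bound by (meson le_imp_less_Suc)
  have len: "2 \<le> length ps" using ps(1) unfolding edge_path_def by blast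
  have "uniform c (V - {ps ! (length ps - 1)}) (ps ! (length ps - 2))"
    by (rule edge_path_end[OF ps(1)]) (use ps(2) in fastforce)
  moreover have "uniform c (V - {rev ps ! (length (rev ps) - 1)}) (rev ps ! (length (rev ps) - 2))"
    by (rule edge_path_end[OF edge_path_rev[OF ps(1)]]) (use ps(2) in fastforce)
  then have "uniform c (V - {ps ! 0}) (ps ! 1)"
    using len by (simp add: rev_nth)
  ultimately show ?thesis
    using edge_path_zigzag[OF ps(1)] by blast
qed

end

theorem prime_set_delete_or_zigzag:
  assumes "finite V" "prime_set c V" "5 \<le> card V" "prime_set c X" "X \<subset> V" "3 \<le> card X"
  shows "(\<exists>v\<in>V. prime_set c (V - {v}) \<and> embeds c X c (V - {v})) \<or>
    (\<exists>m p A B. V = p ` {..<2 * m} \<and> zigzag c m p A B \<and> A \<noteq> B \<and> c (p 1) (p 0) \<noteq> B)"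
proof (subst disj_commute, rule disjCI)
  assume "\<not> (\<exists>v\<in>V. prime_set c (V - {v}) \<and> embeds c X c (V - {v}))"
  then have no_good: "\<And>v. v \<in> V \<Longrightarrow> embeds c X c (V - {v}) \<Longrightarrow> \<not> prime_set c (V - {v})" by blast
  note ctxt = assms(1-3) no_good
  obtain Y where Y: "X \<subseteq> Y" "Y \<subset> V" "prime_set c Y" "card (V - Y) \<le> 2"
    using prime_set_extend_most assms by metis
  have "V - Y \<noteq> {}" using Y(2) by blast
  moreover have "finite (V - Y)" using assms(1) by simp
  ultimately have "card (V - Y) = 1 \<or> card (V - Y) = 2" using Y(4) card_gt_0_iff[of "V - Y"] by linarith
  moreover have "card (V - Y) \<noteq> 1"
  proof
    assume "card (V - Y) = 1"
    then obtain v where "V - Y = {v}" by (rule card_1_singletonE)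
    then have "v \<in> V" "Y = V - {v}" using Y(2) by blast+
    then show False using no_good[of v] Y(1,3) embeds_refl by metis
  qed
  ultimately obtain x y where xy: "V - Y = {x, y}" "x \<noteq> y" by (metis card_2_iff)
  then have "Y = V - {x, y}" using Y(2) by blast
  moreover have "x \<in> V" "y \<in> V" using xy(1) by blast+
  moreover have "embeds c X c Y" using Y(1) by (rule embeds_refl)
  ultimately show "\<exists>m p A B. V = p ` {..<2 * m} \<and> zigzag c m p A B \<and> A \<noteq> B \<and> c (p 1) (p 0) \<noteq> B"
    using delete_edge_zigzag[OF ctxt _ _ xy(2)] Y(3) by blast
qed

end

section \<open>Zigzags and patterns of size 4\<close>

context order_colouring
begin

lemma zigzag_up:
  "zigzag c m p A B \<Longrightarrow> i < j \<Longrightarrow> j < 2 * m \<Longrightarrow> c (p i) (p j) = (if even i \<and> odd j then A else B)"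
  unfolding zigzag_def by blast

lemma zigzag_inj:
  "zigzag c m p A B \<Longrightarrow> i < 2 * m \<Longrightarrow> j < 2 * m \<Longrightarrow> p i = p j \<longleftrightarrow> i = j"
  unfolding zigzag_def by (auto dest: inj_onD)

lemma zigzag_down_eq:
  assumes "zigzag c m p A B" "i < l" "j < l" "l < 2 * m" "even i = even j"
  shows "c (p l) (p i) = c (p l) (p j)"
  by (rule col_rev[of "p i" _ "p j"]) (use assms zigzag_up[OF assms(1)] zigzag_inj[OF assms(1)] in auto)

text \<open>From \<open>p l\<close>, earlier points are seen in the reverse of \<open>A\<close> or
  \<open>B\<close> and later ones in \<open>A\<close> or \<open>B\<close>. No colour is its own
  reverse, so equality would make \<open>B\<close> the reverse of \<open>A\<close>.\<close>

lemma zigzag_between: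
  assumes z: "zigzag c m p A B" and rev: "c (p 1) (p 0) \<noteq> B" and l: "i < l" "l < j" "j < 2 * m"
  shows "c (p l) (p i) \<noteq> c (p l) (p j)"
proof
  assume eq: "c (p l) (p i) = c (p l) (p j)"
  have AB: "c (p i) (p l) \<in> {A, B}" "c (p l) (p j) \<in> {A, B}" using zigzag_up[OF z] l by auto
  have neq: "p 0 \<noteq> p 1" "p i \<noteq> p l" using zigzag_inj[OF z] l by auto
  have A: "c (p 0) (p 1) = A" using zigzag_up[OF z, of 0 1] l by simp
  have "c (p i) (p l) \<noteq> c (p l) (p i)" using col_asym neq by blast
  then consider "c (p i) (p l) = A" "c (p l) (p i) = B" | "c (p i) (p l) = B" "c (p l) (p i) = A"
    using AB eq by auto
  then have "c (p 1) (p 0) = B"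
    using col_rev[of "p 0" "p 1" "p i" "p l"] col_rev[of "p 0" "p 1" "p l" "p i"] neq A by cases auto
  then show False using rev by blast
qed

text \<open>Two points of \<open>M\<close> draw in all indices between them. Adjacent indices differ
  in parity, so both ends of the zigzag tell them apart and belong to \<open>M\<close> as well; the
  ends then draw in everything.\<close>

lemma zigzag_prime:
  assumes z: "zigzag c m p A B" and AB: "A \<noteq> B" and rev: "c (p 1) (p 0) \<noteq> B"
  shows "prime_set c (p ` {..<2 * m})"
  unfolding prime_set_def
proof (intro allI impI)
  fix M assume M: "homogeneous c (p ` {..<2 * m}) M"
  show "M = {} \<or> (\<exists>a. M = {a}) \<or> M = p ` {..<2 * m}"
  proof (cases "M = {} \<or> (\<exists>a. M = {a})")
    case False
    then obtain x y where xy: "x \<in> M" "y \<in> M" "x \<noteq> y" by blast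
    have sub: "M \<subseteq> p ` {..<2 * m}" using M unfolding homogeneous_def by blast
    then obtain i0 j0 where "x = p i0" "y = p j0" "i0 < 2 * m" "j0 < 2 * m" using xy by blast
    then obtain i j where ij: "i < j" "j < 2 * m" "p i \<in> M" "p j \<in> M"
      using xy by (metis nat_neq_iff)
    have hom: "p l \<in> M" if "l < 2 * m" "p a \<in> M" "p b \<in> M" "c (p l) (p a) \<noteq> c (p l) (p b)" for l a b
      using M that unfolding homogeneous_def by blast
    have between: "p l \<in> M" if "a \<le> l" "l \<le> b" "b < 2 * m" "p a \<in> M" "p b \<in> M" for l a b
    proof (cases "l = a \<or> l = b")
      case False
      then show ?thesis using hom[of l a b] zigzag_between[OF z rev, of a l b] that by simp
    qed (use that in auto)
    have i: "p (Suc i) \<in> M" using between[of i "Suc i" j] ij by simp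
    have "p 0 \<in> M"
    proof (cases "i = 0")
      case False
      then have "c (p 0) (p i) \<noteq> c (p 0) (p (Suc i))"
        using zigzag_up[OF z, of 0 i] zigzag_up[OF z, of 0 "Suc i"] AB ij by auto
      then show ?thesis using hom[of 0] i ij by auto
    qed (use ij in simp)
    moreover have "p (2 * m - 1) \<in> M"
    proof (cases "j = 2 * m - 1")
      case False
      let ?e = "2 * m - 1"
      have lt: "Suc i < ?e" using False ij by simp
      have neq: "p i \<noteq> p ?e" "p (Suc i) \<noteq> p ?e" using zigzag_inj[OF z] lt by auto
      have "c (p i) (p ?e) \<noteq> c (p (Suc i)) (p ?e)"
        using zigzag_up[OF z, of i ?e] zigzag_up[OF z, of "Suc i" ?e] AB lt by auto
      then have "c (p ?e) (p i) \<noteq> c (p ?e) (p (Suc i))" using col_rev neq by metis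
      then show ?thesis using hom[of ?e i "Suc i"] i ij by simp
    qed (use ij in simp)
    ultimately have "p l \<in> M" if "l < 2 * m" for l using between[of 0 l "2 * m - 1"] that by simp
    then show ?thesis using sub by blast
  qed blast
qed

section \<open>Prime subsets of a zigzag\<close>

lemma zigzag_twins:
  assumes z: "zigzag c m p A B" and i: "i + 2 < 2 * m"
  shows "twins c (p ` {..<2 * m} - {p (i + 1)}) (p i) (p (i + 2))"
  unfolding twins_def
proof
  fix v assume "v \<in> p ` {..<2 * m} - {p (i + 1)} - {p i, p (i + 2)}"
  then obtain l where l: "l < 2 * m" "v = p l" "l \<noteq> i" "l \<noteq> i + 1" "l \<noteq> i + 2" by blast
  then consider "l < i" | "i + 2 < l" by linarith
  then show "c v (p i) = c v (p (i + 2))"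
  proof cases
    case 1
    then show ?thesis using zigzag_up[OF z, of l i] zigzag_up[OF z, of l "i + 2"] l i by simp
  next
    case 2
    show ?thesis unfolding l by (rule zigzag_down_eq[OF z]) (use 2 l in auto)
  qed
qed

lemma zigzag_uniform_first:
  assumes z: "zigzag c m p A B"
  shows "uniform c (p ` {..<2 * m} - {p 0}) (p 1)"
proof (rule uniformI)
  have "c (p 1) v = B" if v: "v \<in> p ` {..<2 * m} - {p 0}" "v \<noteq> p 1" for v
  proof -
    obtain l where l: "l < 2 * m" "v = p l" using v(1) by blast
    moreover have "l \<noteq> 0" "l \<noteq> 1" using v l(2) by (metis Diff_iff singletonI)+
    ultimately show ?thesis using zigzag_up[OF z, of 1 l] by simp
  qed
  then show "c (p 1) v = c (p 1) w"
    if "v \<in> p ` {..<2 * m} - {p 0}" "w \<in> p ` {..<2 * m} - {p 0}" "v \<noteq> p 1" "w \<noteq> p 1" for v w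
    using that by metis
qed

lemma zigzag_uniform_last:
  assumes z: "zigzag c m p A B"
  shows "uniform c (p ` {..<2 * m} - {p (2 * m - 1)}) (p (2 * m - 2))"
proof (rule uniformI)
  fix v w assume v: "v \<in> p ` {..<2 * m} - {p (2 * m - 1)}" "v \<noteq> p (2 * m - 2)"
    and w: "w \<in> p ` {..<2 * m} - {p (2 * m - 1)}" "w \<noteq> p (2 * m - 2)"
  have index: "\<exists>l. u = p l \<and> l < 2 * m - 2"
    if u: "u \<in> p ` {..<2 * m} - {p (2 * m - 1)}" "u \<noteq> p (2 * m - 2)" for u
  proof -
    obtain l where l: "l < 2 * m" "u = p l" using u(1) by blast
    moreover have "l \<noteq> 2 * m - 1" "l \<noteq> 2 * m - 2" using u l by auto
    ultimately have "l < 2 * m - 2" by linarith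
    then show ?thesis using l by blast
  qed
  obtain k l where kl: "v = p k" "k < 2 * m - 2" "w = p l" "l < 2 * m - 2" using index v w by meson
  have "c v (p (2 * m - 2)) = c w (p (2 * m - 2))"
    using zigzag_up[OF z, of k "2 * m - 2"] zigzag_up[OF z, of l "2 * m - 2"] kl by auto
  then show "c (p (2 * m - 2)) v = c (p (2 * m - 2)) w" using col_rev v w by metis
qed

text \<open>Without \<open>p i\<close> its two neighbours are twins or, at an end of the zigzag, its
  only neighbour is uniform. A prime \<open>X\<close> tolerates neither, so a neighbour is missing
  as well.\<close>

lemma zigzag_skip_pair:
  assumes z: "zigzag c m p A B" and X: "prime_set c X" "3 \<le> card X" "X \<subset> p ` {..<2 * m}"
  obtains j where "Suc j < 2 * m" "p j \<notin> X" "p (Suc j) \<notin> X"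
proof -
  obtain i where i: "i < 2 * m" "p i \<notin> X" using X(3) by blast
  let ?V = "p ` {..<2 * m}"
  have sub: "X \<subseteq> ?V - {p i}" using psubset_imp_subset[OF X(3)] i(2) by auto
  have nu: "y \<notin> X" if "uniform c (?V - {p i}) y" for y
  proof
    assume "y \<in> X"
    moreover have "uniform c X y"
      by (rule uniformI) (use sub in \<open>auto intro!: uniformD[OF that]\<close>)
    ultimately show False using prime_set_not_uniform X(1,2) by metis
  qed
  consider "i = 0" | "i = 2 * m - 1" | l where "i = l + 1" "l + 2 < 2 * m"
    using i by (metis Suc_eq_plus1 Suc_lessI add_2_eq_Suc' diff_Suc_1 not0_implies_Suc)
  then show ?thesis
  proof cases
    case 1
    then show ?thesis using that[of 0] nu[of "p 1"] zigzag_uniform_first[OF z] i by simp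
  next
    case 2
    have "Suc (2 * m - 2) = i" using i 2 by (cases m) auto
    then show ?thesis using that[of "2 * m - 2"] nu[of "p (2 * m - 2)"] zigzag_uniform_last[OF z] i 2 by simp
  next
    case 3
    have "twins c X (p l) (p (l + 2))"
      unfolding twins_def
    proof
      fix v assume "v \<in> X - {p l, p (l + 2)}"
      then show "c v (p l) = c v (p (l + 2))"
        by (intro twinsD[OF zigzag_twins[OF z 3(2)]]) (use sub 3(1) in auto)
    qed
    moreover have "p l \<noteq> p (l + 2)" using zigzag_inj[OF z] 3 by simp
    ultimately have "p l \<notin> X \<or> p (l + 2) \<notin> X" using prime_set_not_twins X(1,2) by metis
    then show ?thesis using that[of l] that[of "Suc l"] i 3 by auto
  qed
qed

lemma zigzag_delete_not_prime:
  assumes z: "zigzag c m p A B" and m: "2 \<le> m" and i: "i < 2 * m"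
  shows "\<not> prime_set c (p ` {..<2 * m} - {p i})"
proof
  let ?V = "p ` {..<2 * m}"
  assume prime: "prime_set c (?V - {p i})"
  have "card ?V = 2 * m" using z unfolding zigzag_def by (simp add: card_image)
  then have card: "3 \<le> card (?V - {p i})" using i m by simp
  have "?V - {p i} \<subset> ?V" using i by auto
  then obtain j where j: "Suc j < 2 * m" "p j \<notin> ?V - {p i}" "p (Suc j) \<notin> ?V - {p i}"
    by (rule zigzag_skip_pair[OF z prime card])
  then have "p j = p i" "p (Suc j) = p i" by auto
  then show False using zigzag_inj[OF z, of j "Suc j"] j by simp
qed

text \<open>Closing the gap left by two adjacent missing indices shifts the later indices by two,
  which keeps order and parity and therefore all colours.\<close>

lemma zigzag_prime_subset_embeds:
  assumes z: "zigzag c (Suc m) p A B" and X: "prime_set c X" "3 \<le> card X" "X \<subset> p ` {..<2 * Suc m}"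
  shows "embeds c X c (p ` {..<2 * m})"
proof -
  obtain j where j: "Suc j < 2 * Suc m" "p j \<notin> X" "p (Suc j) \<notin> X"
    by (rule zigzag_skip_pair[OF z X])
  define h where "h l = (if l < j then l else l - 2)" for l :: nat
  define ix where "ix = inv_into {..<2 * Suc m} p"
  have ix: "ix x < 2 * Suc m" "p (ix x) = x" "ix x \<noteq> j" "ix x \<noteq> Suc j" if "x \<in> X" for x
  proof -
    have "x \<in> p ` {..<2 * Suc m}" using X(3) that by blast
    from inv_into_into[OF this] f_inv_into_f[OF this] show "ix x < 2 * Suc m" "p (ix x) = x"
      unfolding ix_def by simp_all
    then show "ix x \<noteq> j" "ix x \<noteq> Suc j" using j that by auto
  qed
  have h: "h l < 2 * m" "even (h l) = even l" if "l < 2 * Suc m" "l \<noteq> j" "l \<noteq> Suc j" for l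
    using that j(1) unfolding h_def by auto
  have hmono: "h k < h l \<longleftrightarrow> k < l" if "k \<noteq> j" "k \<noteq> Suc j" "l \<noteq> j" "l \<noteq> Suc j" for k l
    using that unfolding h_def by auto
  let ?f = "\<lambda>x. p (h (ix x))"
  have less: "c (?f x) (?f y) = c x y" "c (?f y) (?f x) = c y x" "?f x \<noteq> ?f y"
    if "x \<in> X" "y \<in> X" "ix x < ix y" for x y
  proof -
    have hl: "h (ix x) < h (ix y)" "h (ix y) < 2 * m" using hmono h ix that by auto
    have "c (?f x) (?f y) = c (p (ix x)) (p (ix y))"
      using zigzag_up[OF z, of "h (ix x)" "h (ix y)"] zigzag_up[OF z, of "ix x" "ix y"] hl
        h(2)[OF ix(1,3,4)] that ix(1) by simp
    then show 1: "c (?f x) (?f y) = c x y" using ix that by simp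
    show 2: "?f x \<noteq> ?f y" using zigzag_inj[OF z] hl by simp
    show "c (?f y) (?f x) = c y x" by (rule col_rev[OF 2 _ 1]) (use that in auto)
  qed
  have ne: "ix x < ix y \<or> ix y < ix x" if "x \<in> X" "y \<in> X" "x \<noteq> y" for x y
    using ix(2) that by (metis nat_neq_iff)
  show ?thesis unfolding embeds_def
  proof (intro exI[of _ ?f] conjI ballI impI)
    show "inj_on ?f X" by (rule inj_onI) (metis less(3) ne)
    show "?f ` X \<subseteq> p ` {..<2 * m}" using h(1) ix by blast
    show "c (?f x) (?f y) = c x y" if "x \<in> X" "y \<in> X" "x \<noteq> y" for x y
      using less ne that by metis
  qed
qed

end

section \<open>Decomposition into direct and skew sums\<close>

definition separated :: "(nat \<Rightarrow> nat \<Rightarrow> bool) \<Rightarrow> nat set \<Rightarrow> bool" where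
  "separated \<rho> V \<longleftrightarrow> (\<exists>L R. L \<noteq> {} \<and> R \<noteq> {} \<and> L \<union> R = V \<and> (\<forall>l\<in>L. \<forall>r\<in>R. l < r \<and> \<rho> l r))"

text \<open>Step of an induction on the last position. The relation \<open>\<rho>\<close> is
  abstract so that it can be the order of the values or its reverse; the points found, followed by
  \<open>x\<close>, form 3142 in the first case and 2413 in the second.\<close>

lemma separated_insert_max:
  assumes fin: "finite V" and sep: "separated \<rho> V" and max: "\<forall>v\<in>V. v < x"
    and trans: "\<And>a b d. \<rho> a b \<Longrightarrow> \<rho> b d \<Longrightarrow> \<rho> a d" and irrefl: "\<And>a. \<not> \<rho> a a"
    and total: "\<And>a b. a \<noteq> b \<Longrightarrow> \<rho> a b \<or> \<rho> b a"
  shows "separated \<rho> (insert x V) \<or> separated (\<lambda>a b. \<rho> b a) (insert x V)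
    \<or> (\<exists>a\<in>V. \<exists>b\<in>V. \<exists>d\<in>V. a < b \<and> b < d \<and> \<rho> b x \<and> \<rho> x a \<and> \<rho> a d)"
proof -
  define P where "P L R \<longleftrightarrow> L \<noteq> {} \<and> R \<noteq> {} \<and> L \<union> R = V \<and> (\<forall>l\<in>L. \<forall>r\<in>R. l < r \<and> \<rho> l r)" for L R
  obtain L R where LR: "P L R" and least: "\<And>L' R'. P L' R' \<Longrightarrow> card L \<le> card L'"
  proof -
    have "\<exists>k L R. P L R \<and> card L = k" using sep unfolding separated_def P_def by blast
    then obtain L R where 1: "P L R" "card L = (LEAST k. \<exists>L R. P L R \<and> card L = k)"
      using LeastI_ex[of "\<lambda>k. \<exists>L R. P L R \<and> card L = k"] by blast
    show thesis
      by (rule that[OF 1(1)]) (unfold 1(2), rule Least_le, blast)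
  qed
  have LRV: "L \<noteq> {}" "R \<noteq> {}" "L \<union> R = V" "\<And>l r. l \<in> L \<Longrightarrow> r \<in> R \<Longrightarrow> l < r \<and> \<rho> l r"
    using LR unfolding P_def by blast+
  show ?thesis
  proof (cases "(\<forall>v\<in>V. \<rho> x v) \<or> (\<forall>l\<in>L. \<rho> l x)")
    case True
    then show ?thesis
    proof
      assume "\<forall>v\<in>V. \<rho> x v"
      then have "separated (\<lambda>a b. \<rho> b a) (insert x V)"
        unfolding separated_def using max LRV by (intro exI[of _ V] exI[of _ "{x}"]) auto
      then show ?thesis by blast
    next
      assume "\<forall>l\<in>L. \<rho> l x"
      then have "separated \<rho> (insert x V)"
        unfolding separated_def using max LRV by (intro exI[of _ L] exI[of _ "insert x R"]) auto
      then show ?thesis by blast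
    qed
  next
    case False
    then obtain a b where a: "a \<in> L" "\<rho> x a" and b: "b \<in> V" "\<rho> b x"
      using total max LRV(3) by (metis Un_iff less_irrefl)
    have "b \<in> L"
    proof (rule ccontr)
      assume "b \<notin> L"
      then have "\<rho> a b" using b a LRV by blast
      then show False using a b trans irrefl by blast
    qed
    let ?A = "{l \<in> L. \<rho> x l}" and ?B = "{l \<in> L. \<rho> l x}"
    have "\<exists>a\<in>?A. \<exists>b\<in>?B. a < b"
    proof (rule ccontr)
      assume neg: "\<not> ?thesis"
      \<comment> \<open>If no point of \<open>?A\<close> precedes a point of \<open>?B\<close>, the
        cut between them is again a separation, against the minimal choice of
        \<open>L\<close>.\<close>
      have "P ?B (?A \<union> R)" unfolding P_def
      proof (intro conjI ballI)
        show "?B \<noteq> {}" using \<open>b \<in> L\<close> b by blast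
        show "?A \<union> R \<noteq> {}" using a by blast
        have "L = ?A \<union> ?B" using total max LRV(3) by (auto, metis UnI1 less_irrefl)
        then show "?B \<union> (?A \<union> R) = V" using LRV(3) by blast
        fix l r assume lr: "l \<in> ?B" "r \<in> ?A \<union> R"
        show "l < r"
        proof (cases "r \<in> R")
          case False
          then have "r \<in> ?A" using lr by blast
          moreover have "l \<noteq> r" using lr(1) \<open>r \<in> ?A\<close> trans irrefl by blast
          ultimately show ?thesis using neg lr(1) by (meson linorder_neqE_nat)
        qed (use lr LRV(4) in blast)
        show "\<rho> l r" using lr LRV(4) trans by blast
      qed
      then have "card L \<le> card ?B" by (rule least)
      moreover have "finite L" using fin LRV(3) by blast
      moreover have "?B \<subset> L" using a trans irrefl by blast
      ultimately show False using psubset_card_mono by (metis not_le)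
    qed
    then obtain a b where ab: "a \<in> L" "\<rho> x a" "b \<in> L" "\<rho> b x" "a < b" by blast
    obtain d where "d \<in> R" using LRV by blast
    then show ?thesis using ab LRV by blast
  qed
qed

definition colour :: "(nat \<Rightarrow> nat) \<Rightarrow> nat \<Rightarrow> nat \<Rightarrow> bool \<times> bool" where
  "colour s i j = (i < j, s i < s j)"

lemma order_colouring_colour: "inj s \<Longrightarrow> order_colouring (colour s)"
  by unfold_locales (auto simp: colour_def inj_eq not_less_iff_gr_or_eq)

text \<open>The classical fact that permutations avoiding 2413 and 3142 are direct or skew sums.
  Positions form an arbitrary finite set, so that the induction can drop the last one without
  standardizing.\<close>

lemma separable:
  fixes s :: "nat \<Rightarrow> nat"
  assumes "inj s" "finite V" "2 \<le> card V"
    and no_pattern: "\<And>a b d e. a \<in> V \<Longrightarrow> b \<in> V \<Longrightarrow> d \<in> V \<Longrightarrow> e \<in> V \<Longrightarrow> a < b \<Longrightarrow> b < d \<Longrightarrow> d < e \<Longrightarrow>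
      \<not> (s b < s e \<and> s e < s a \<and> s a < s d) \<and> \<not> (s d < s a \<and> s a < s e \<and> s e < s b)"
  shows "separated (\<lambda>a b. s a < s b) V \<or> separated (\<lambda>a b. s b < s a) V"
  using assms(2-4)
proof (induction V rule: finite_linorder_max_induct)
  case (insert x V)
  have neq: "s a < s b \<or> s b < s a" if "a \<noteq> b" for a b
  proof -
    have "s a \<noteq> s b" using inj_eq[OF assms(1)] that by simp
    then show ?thesis by linarith
  qed
  show ?case
  proof (cases "2 \<le> card V")
    case True
    have np: "\<not> (s b < s e \<and> s e < s a \<and> s a < s d) \<and> \<not> (s d < s a \<and> s a < s e \<and> s e < s b)"
      if "a \<in> V" "b \<in> V" "d \<in> V" "e \<in> insert x V" "a < b" "b < d" "d < e" for a b d e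
      by (rule insert.prems(2)) (use that in auto)
    have "separated (\<lambda>a b. s a < s b) V \<or> separated (\<lambda>a b. s b < s a) V"
      by (rule insert.IH[OF True], rule np) auto
    then show ?thesis
    proof
      assume "separated (\<lambda>a b. s a < s b) V"
      from separated_insert_max[OF insert.hyps(1) this insert.hyps(2)] neq
      have "?thesis \<or> (\<exists>a\<in>V. \<exists>b\<in>V. \<exists>d\<in>V. a < b \<and> b < d \<and> s b < s x \<and> s x < s a \<and> s a < s d)"
        by auto
      then show ?thesis using np[where e = x] insert.hyps(2) by blast
    next
      assume "separated (\<lambda>a b. s b < s a) V"
      from separated_insert_max[OF insert.hyps(1) this insert.hyps(2)] neq
      have "?thesis \<or> (\<exists>a\<in>V. \<exists>b\<in>V. \<exists>d\<in>V. a < b \<and> b < d \<and> s x < s b \<and> s a < s x \<and> s d < s a)"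
        by auto
      then show ?thesis using np[where e = x] insert.hyps(2) by blast
    qed
  next
    case False
    then have "card V = 1" using insert.prems(1) insert.hyps by (simp add: card_insert_if split: if_splits)
    then obtain v where v: "V = {v}" by (rule card_1_singletonE)
    have sep: "separated \<rho> (insert x V)" if "\<rho> v x" for \<rho> :: "nat \<Rightarrow> nat \<Rightarrow> bool"
      unfolding separated_def using that v insert.hyps(2)
      by (intro exI[of _ "{v}"] exI[of _ "{x}"]) auto
    have "s v < s x \<or> s x < s v" using neq[of v x] v insert.hyps(2) by auto
    then show ?thesis
      using sep[of "\<lambda>a b. s a < s b"] sep[of "\<lambda>a b. s b < s a"] by auto
  qed
qed simp

text \<open>Both parts of a separation are homogeneous, hence singletons in a prime set, which would
  leave only two points.\<close>

lemma prime_set_contains_pattern: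
  assumes s: "inj s" and V: "finite V" "prime_set (colour s) V" "3 \<le> card V"
  obtains a b d e where "a \<in> V" "b \<in> V" "d \<in> V" "e \<in> V" "a < b" "b < d" "d < e"
    "s b < s e \<and> s e < s a \<and> s a < s d \<or> s d < s a \<and> s a < s e \<and> s e < s b"
proof -
  have "\<not> separated \<rho> V" if "\<rho> = (\<lambda>a b. s a < s b) \<or> \<rho> = (\<lambda>a b. s b < s a)" for \<rho>
  proof
    assume "separated \<rho> V"
    then obtain L R where LR: "L \<noteq> {}" "R \<noteq> {}" "L \<union> R = V" "\<And>l r. l \<in> L \<Longrightarrow> r \<in> R \<Longrightarrow> l < r \<and> \<rho> l r"
      unfolding separated_def by blast
    have col: "colour s l r = colour s l r'" "colour s r l = colour s r l'"
      if "l \<in> L" "r \<in> R" "l' \<in> L" "r' \<in> R" for l r l' r'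
      using LR(4)[of l r] LR(4)[of l r'] LR(4)[of l' r] \<open>\<rho> = _ \<or> _\<close> that unfolding colour_def by auto
    have "homogeneous (colour s) V L" "homogeneous (colour s) V R"
      unfolding homogeneous_def using LR(3) col by blast+
    moreover have "L \<noteq> V" "R \<noteq> V" using LR less_irrefl by blast+
    ultimately have "(\<exists>a. L = {a}) \<and> (\<exists>a. R = {a})"
      using V(2) LR(1,2) unfolding prime_set_def by blast
    then obtain a b where "V = {a, b}" using LR(3) by blast
    moreover have "card {a, b} \<le> 2" by (simp add: card_insert_if)
    ultimately show False using V(3) by simp
  qed
  then have "\<not> (separated (\<lambda>a b. s a < s b) V \<or> separated (\<lambda>a b. s b < s a) V)" by blast
  then show thesis using separable[OF s V(1)] V(3) that by fastforce
qed

section \<open>Permutations as coloured sets\<close>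

text \<open>
  Extending a permutation beyond its size by \<open>i \<mapsto> i + 1\<close> makes it injective on all indices.
\<close>

definition val :: "nat list \<Rightarrow> nat \<Rightarrow> nat" where
  "val \<sigma> i = (if i < length \<sigma> then \<sigma> ! i else Suc i)"

abbreviation col :: "nat list \<Rightarrow> nat \<Rightarrow> nat \<Rightarrow> bool \<times> bool" where
  "col \<sigma> \<equiv> colour (val \<sigma>)"

lemma perm_iff: "perm \<sigma> \<longleftrightarrow> \<sigma> \<noteq> [] \<and> distinct \<sigma> \<and> set \<sigma> = {1..length \<sigma>}"
  unfolding perm_def permutations_of_set_def by auto

lemma permI:
  assumes "\<sigma> \<noteq> []" "distinct \<sigma>" "set \<sigma> \<subseteq> {1..length \<sigma>}"
  shows "perm \<sigma>"
proof -
  have "card (set \<sigma>) = card {1..length \<sigma>}" using assms(2) by (simp add: distinct_card)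
  then have "set \<sigma> = {1..length \<sigma>}" using assms(3) card_subset_eq[of "{1..length \<sigma>}"] by blast
  then show ?thesis using assms unfolding perm_iff by blast
qed

lemma inj_val:
  assumes "perm \<sigma>"
  shows "inj (val \<sigma>)"
proof (rule injI)
  fix i j assume eq: "val \<sigma> i = val \<sigma> j"
  have "\<sigma> ! i \<le> length \<sigma>" if "i < length \<sigma>" for i
    using assms that nth_mem[OF that] unfolding perm_iff by auto
  then show "i = j"
    using eq assms unfolding val_def perm_iff by (auto simp: nth_eq_iff_index_eq split: if_splits) force+
qed

lemma order_colouring_col: "perm \<sigma> \<Longrightarrow> order_colouring (col \<sigma>)"
  by (intro order_colouring_colour inj_val)

section \<open>Patterns as embeddings\<close>

lemma subseq_iff_nth:
  "subseq xs ys \<longleftrightarrow> (\<exists>f. (\<forall>i<length xs. f i < length ys \<and> ys ! f i = xs ! i) \<and>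
     (\<forall>i<length xs. \<forall>j<length xs. i < j \<longrightarrow> f i < f j))" (is "_ \<longleftrightarrow> ?R xs ys")
proof
  assume "subseq xs ys"
  then show "?R xs ys"
  proof (induction rule: list_emb.induct)
    case (list_emb_Cons xs ys y)
    then obtain f where "(\<forall>i<length xs. f i < length ys \<and> ys ! f i = xs ! i) \<and>
        (\<forall>i<length xs. \<forall>j<length xs. i < j \<longrightarrow> f i < f j)" by blast
    then show ?case by (intro exI[of _ "\<lambda>i. Suc (f i)"]) auto
  next
    case (list_emb_Cons2 x y xs ys)
    then obtain f where "(\<forall>i<length xs. f i < length ys \<and> ys ! f i = xs ! i) \<and>
        (\<forall>i<length xs. \<forall>j<length xs. i < j \<longrightarrow> f i < f j)" by blast
    then show ?case using list_emb_Cons2(1)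
      by (intro exI[of _ "\<lambda>i. case i of 0 \<Rightarrow> 0 | Suc k \<Rightarrow> Suc (f k)"]) (auto split: nat.splits)
  qed auto
next
  assume "?R xs ys"
  then obtain f where f: "\<forall>i<length xs. f i < length ys \<and> ys ! f i = xs ! i"
    "\<forall>i<length xs. \<forall>j<length xs. i < j \<longrightarrow> f i < f j" by blast
  then show "subseq xs ys"
  proof (induction ys arbitrary: xs f)
    case Nil
    then have "length xs = 0" by (metis list.size(3) not_gr_zero not_less0)
    then show ?case by simp
  next
    case (Cons y ys)
    show ?case
    proof (cases xs)
      case xs: (Cons x xs')
      show ?thesis
      proof (cases "f 0 = 0")
        case True
        have pos: "f (Suc i) \<noteq> 0" if "i < length xs'" for i
          using Cons.prems(2)[rule_format, of 0 "Suc i"] that xs by simp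
        have "subseq xs' ys"
        proof (rule Cons.IH)
          show "\<forall>i<length xs'. f (Suc i) - 1 < length ys \<and> ys ! (f (Suc i) - 1) = xs' ! i"
          proof (intro allI impI)
            fix i assume i: "i < length xs'"
            have "f (Suc i) < length (y # ys) \<and> (y # ys) ! f (Suc i) = xs ! Suc i"
              using Cons.prems(1) i xs by simp
            then show "f (Suc i) - 1 < length ys \<and> ys ! (f (Suc i) - 1) = xs' ! i"
              using pos[OF i] xs by (cases "f (Suc i)") auto
          qed
          show "\<forall>i<length xs'. \<forall>j<length xs'. i < j \<longrightarrow> f (Suc i) - 1 < f (Suc j) - 1"
          proof (intro allI impI)
            fix i j assume ij: "i < length xs'" "j < length xs'" "i < j"
            then have "f (Suc i) < f (Suc j)" using Cons.prems(2) xs by simp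
            then show "f (Suc i) - 1 < f (Suc j) - 1" using pos[OF ij(1)] by simp
          qed
        qed
        moreover have "x = y" using Cons.prems(1)[rule_format, of 0] True xs by simp
        ultimately show ?thesis using xs by simp
      next
        case False
        have pos: "f i \<noteq> 0" if "i < length xs" for i
          using Cons.prems(2)[rule_format, of 0 i] that False xs by (cases i) auto
        have "subseq xs ys"
        proof (rule Cons.IH)
          show "\<forall>i<length xs. f i - 1 < length ys \<and> ys ! (f i - 1) = xs ! i"
          proof (intro allI impI)
            fix i assume i: "i < length xs"
            then show "f i - 1 < length ys \<and> ys ! (f i - 1) = xs ! i"
              using pos[OF i] Cons.prems(1)[rule_format, OF i] by (cases "f i") auto
          qed
          show "\<forall>i<length xs. \<forall>j<length xs. i < j \<longrightarrow> f i - 1 < f j - 1"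
          proof (intro allI impI)
            fix i j assume ij: "i < length xs" "j < length xs" "i < j"
            then have "f i < f j" using Cons.prems(2) by simp
            then show "f i - 1 < f j - 1" using pos[OF ij(1)] by simp
          qed
        qed
        then show ?thesis by (rule list_emb_Cons)
      qed
    qed simp
  qed
qed

text \<open>The first component of the colour makes an embedding increasing on positions, hence a
  subsequence; the second makes it preserve the order of the values.\<close>

lemma is_pattern_iff_embeds:
  assumes "perm \<beta>" "perm \<sigma>"
  shows "is_pattern \<beta> \<sigma> \<longleftrightarrow> embeds (col \<beta>) {..<length \<beta>} (col \<sigma>) {..<length \<sigma>}"
proof
  assume "is_pattern \<beta> \<sigma>"
  then obtain s where s: "subseq s \<sigma>" "order_isomorphic s \<beta>" unfolding is_pattern_def by blast
  have len: "length s = length \<beta>" using s(2) unfolding order_isomorphic_def by blast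
  obtain f where f: "\<And>i. i < length \<beta> \<Longrightarrow> f i < length \<sigma> \<and> \<sigma> ! f i = s ! i"
    "\<And>i j. i < length \<beta> \<Longrightarrow> j < length \<beta> \<Longrightarrow> i < j \<Longrightarrow> f i < f j"
    using s(1) len unfolding subseq_iff_nth by metis
  have iff: "f i < f j \<longleftrightarrow> i < j" if "i < length \<beta>" "j < length \<beta>" for i j
    using f(2)[of i j] f(2)[of j i] that by (cases i j rule: linorder_cases) auto
  have "inj_on f {..<length \<beta>}"
    by (rule inj_onI) (metis iff lessThan_iff nat_neq_iff)
  moreover have "col \<sigma> (f i) (f j) = col \<beta> i j" if "i < length \<beta>" "j < length \<beta>" for i j
    using s(2) f(1) iff that len unfolding colour_def val_def order_isomorphic_def by simp
  ultimately show "embeds (col \<beta>) {..<length \<beta>} (col \<sigma>) {..<length \<sigma>}"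
    unfolding embeds_def using f(1) by (intro exI[of _ f]) auto
next
  assume "embeds (col \<beta>) {..<length \<beta>} (col \<sigma>) {..<length \<sigma>}"
  then obtain f where f: "f ` {..<length \<beta>} \<subseteq> {..<length \<sigma>}"
    "\<And>i j. i < length \<beta> \<Longrightarrow> j < length \<beta> \<Longrightarrow> i \<noteq> j \<Longrightarrow> col \<sigma> (f i) (f j) = col \<beta> i j"
    unfolding embeds_def by auto
  have range: "f i < length \<sigma>" if "i < length \<beta>" for i using f(1) that by auto
  define s where "s = map (\<lambda>i. \<sigma> ! f i) [0..<length \<beta>]"
  have "subseq s \<sigma>"
    unfolding subseq_iff_nth
  proof (intro exI[of _ f] conjI allI impI)
    fix i j assume "i < length s" "j < length s" "i < j"
    then show "f i < f j" using f(2)[of i j] unfolding s_def colour_def by simp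
  qed (use range in \<open>auto simp: s_def\<close>)
  moreover have "\<sigma> ! f i < \<sigma> ! f j \<longleftrightarrow> \<beta> ! i < \<beta> ! j" if "i < length \<beta>" "j < length \<beta>" for i j
    using f(2)[of i j] range that unfolding colour_def val_def by (cases "i = j") auto
  then have "order_isomorphic s \<beta>" unfolding order_isomorphic_def s_def by simp
  ultimately show "is_pattern \<beta> \<sigma>" unfolding is_pattern_def by blast
qed

text \<open>Each entry is one more than the number of smaller entries, so the comparisons determine
  it.\<close>

lemma perm_eq_of_order_isomorphic:
  assumes "perm \<sigma>" "perm \<tau>" "order_isomorphic \<sigma> \<tau>"
  shows "\<sigma> = \<tau>"
proof (rule nth_equalityI)
  show len: "length \<sigma> = length \<tau>" using assms(3) unfolding order_isomorphic_def by blast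
  have rank: "\<rho> ! i = Suc (card {j. j < length \<rho> \<and> \<rho> ! j < \<rho> ! i})" if "perm \<rho>" "i < length \<rho>" for \<rho> i
  proof -
    have inj: "inj_on ((!) \<rho>) {j. j < length \<rho> \<and> \<rho> ! j < \<rho> ! i}"
      using that unfolding perm_iff by (auto intro!: inj_onI simp: nth_eq_iff_index_eq)
    have mem: "\<rho> ! i \<in> {1..length \<rho>}" using that nth_mem[of i \<rho>] unfolding perm_iff by blast
    have "(!) \<rho> ` {j. j < length \<rho> \<and> \<rho> ! j < \<rho> ! i} = {x \<in> set \<rho>. x < \<rho> ! i}"
      by (auto simp: in_set_conv_nth)
    also have "\<dots> = {1..<\<rho> ! i}" using that(1) mem unfolding perm_iff by auto
    finally have "card {j. j < length \<rho> \<and> \<rho> ! j < \<rho> ! i} = \<rho> ! i - 1"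
      using card_image[OF inj] by simp
    then show ?thesis using mem by simp
  qed
  show "\<sigma> ! i = \<tau> ! i" if "i < length \<sigma>" for i
  proof -
    have "{j. j < length \<sigma> \<and> \<sigma> ! j < \<sigma> ! i} = {j. j < length \<tau> \<and> \<tau> ! j < \<tau> ! i}"
      using assms(3) that len unfolding order_isomorphic_def by auto
    then show ?thesis using rank[OF assms(1) that] rank[OF assms(2), of i] that len by simp
  qed
qed

lemma is_pattern_length_le: "is_pattern \<beta> \<sigma> \<Longrightarrow> length \<beta> \<le> length \<sigma>"
  unfolding is_pattern_def order_isomorphic_def by (auto dest!: list_emb_length)

lemma is_pattern_same_length:
  assumes "perm \<beta>" "perm \<sigma>" "is_pattern \<beta> \<sigma>" "length \<beta> = length \<sigma>"
  shows "\<beta> = \<sigma>"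
proof -
  obtain s where s: "subseq s \<sigma>" "order_isomorphic s \<beta>" using assms(3) unfolding is_pattern_def by blast
  then have "length s = length \<sigma>" using assms(4) unfolding order_isomorphic_def by simp
  then have "s = \<sigma>" using s(1) subseq_same_length by blast
  then show ?thesis using perm_eq_of_order_isomorphic assms(1,2) s(2) by blast
qed

section \<open>Intervals as homogeneous sets\<close>

lemma homogeneous_imp_perm_interval:
  assumes \<sigma>: "perm \<sigma>" and M: "homogeneous (col \<sigma>) {..<length \<sigma>} M" "M \<noteq> {}"
  shows "perm_interval \<sigma> M"
proof -
  have sub: "M \<subseteq> {..<length \<sigma>}" using M(1) unfolding homogeneous_def by blast
  then have fin: "finite M" using finite_subset by blast
  have hom: "col \<sigma> l i = col \<sigma> l j" if "l < length \<sigma>" "l \<notin> M" "i \<in> M" "j \<in> M" for l i j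
    using M(1) that unfolding homogeneous_def by blast
  \<comment> \<open>A position missing between the extremes would have them on different sides, and
    the first component of the colour records this.\<close>
  have "M = {Min M..Max M}"
  proof
    show "{Min M..Max M} \<subseteq> M"
    proof (rule subsetI, rule ccontr)
      fix l assume l: "l \<in> {Min M..Max M}" "l \<notin> M"
      have "Max M < length \<sigma>" using Max_in[OF fin M(2)] sub by blast
      then have "l < length \<sigma>" using l(1) by simp
      then have "col \<sigma> l (Min M) = col \<sigma> l (Max M)"
        using hom[OF _ l(2) Min_in[OF fin M(2)] Max_in[OF fin M(2)]] by blast
      moreover have "l \<noteq> Max M" using l(2) Max_in[OF fin M(2)] by blast
      ultimately show False using l(1) unfolding colour_def by auto
    qed
  qed (use fin in auto)
  moreover have "Max M < length \<sigma>" "Min M \<le> Max M" using Max_in[OF fin M(2)] fin M(2) sub by auto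
  moreover have "(!) \<sigma> ` M = {Min ((!) \<sigma> ` M)..Max ((!) \<sigma> ` M)}" (is "?J = _")
  proof
    have finJ: "finite ?J" and neJ: "?J \<noteq> {}" using fin M(2) by auto
    show "{Min ?J..Max ?J} \<subseteq> ?J"
    proof (rule subsetI, rule ccontr)
      \<comment> \<open>A missing value belongs to a position \<open>l\<close> outside
        \<open>M\<close>, and the second component of the colour tells the points of extreme value
        apart.\<close>
      fix u assume u: "u \<in> {Min ?J..Max ?J}" "u \<notin> ?J"
      obtain i where i: "i \<in> M" "\<sigma> ! i = Min ?J" using Min_in[OF finJ neJ] by auto
      obtain j where j: "j \<in> M" "\<sigma> ! j = Max ?J" using Max_in[OF finJ neJ] by auto
      have len: "i < length \<sigma>" "j < length \<sigma>" using i j sub by auto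
      then have "\<sigma> ! i \<in> {1..length \<sigma>}" "\<sigma> ! j \<in> {1..length \<sigma>}"
        using nth_mem \<sigma> unfolding perm_iff by blast+
      then have "u \<in> set \<sigma>" using u(1) i j \<sigma> unfolding perm_iff by auto
      then obtain l where l: "l < length \<sigma>" "\<sigma> ! l = u" by (auto simp: in_set_conv_nth)
      then have "l \<notin> M" using u(2) by blast
      then have "col \<sigma> l i = col \<sigma> l j" using hom l i j by blast
      moreover have "u \<noteq> \<sigma> ! j" "u \<noteq> \<sigma> ! i" using u(2) i(1) j(1) by blast+
      ultimately show False using u(1) i j l len unfolding colour_def val_def by auto
    qed
  qed (use fin in auto)
  ultimately show ?thesis unfolding perm_interval_def by blast
qed

lemma perm_interval_imp_homogeneous:
  assumes \<sigma>: "perm \<sigma>" and I: "perm_interval \<sigma> I"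
  shows "homogeneous (col \<sigma>) {..<length \<sigma>} I"
proof -
  obtain i j a b where ij: "i \<le> j" "j < length \<sigma>" "I = {i..j}" and ab: "(!) \<sigma> ` I = {a..b}"
    using I unfolding perm_interval_def by blast
  have "col \<sigma> l x = col \<sigma> l y" if l: "l < length \<sigma>" "l \<notin> I" and xy: "x \<in> I" "y \<in> I" for l x y
  proof -
    have len: "x < length \<sigma>" "y < length \<sigma>" using xy ij by auto
    have "\<sigma> ! l \<notin> (!) \<sigma> ` I"
    proof
      assume "\<sigma> ! l \<in> (!) \<sigma> ` I"
      then obtain k where "k \<in> I" "\<sigma> ! l = \<sigma> ! k" by blast
      moreover have "k < length \<sigma>" using \<open>k \<in> I\<close> ij by auto
      ultimately have "l = k" using \<sigma> l nth_eq_iff_index_eq unfolding perm_iff by blast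
      then show False using l \<open>k \<in> I\<close> by blast
    qed
    then have "\<sigma> ! l \<notin> {a..b}" using ab by simp
    moreover have "\<sigma> ! x \<in> {a..b}" "\<sigma> ! y \<in> {a..b}" using ab xy by blast+
    ultimately have "(\<sigma> ! l < \<sigma> ! x) = (\<sigma> ! l < \<sigma> ! y)" by auto
    moreover have "(l < x) = (l < y)" using l xy ij by auto
    ultimately show ?thesis using l len unfolding colour_def val_def by simp
  qed
  moreover have "I \<subseteq> {..<length \<sigma>}" using ij by auto
  ultimately show ?thesis unfolding homogeneous_def by blast
qed

lemma simple_iff_prime:
  assumes "perm \<sigma>"
  shows "simple \<sigma> \<longleftrightarrow> prime_set (col \<sigma>) {..<length \<sigma>}"
proof
  assume "simple \<sigma>"
  then show "prime_set (col \<sigma>) {..<length \<sigma>}"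
    unfolding prime_set_def simple_def is_singleton_def
    using homogeneous_imp_perm_interval[OF assms] by meson
next
  assume prime: "prime_set (col \<sigma>) {..<length \<sigma>}"
  have "is_singleton I \<or> I = {..<length \<sigma>}" if I: "perm_interval \<sigma> I" for I
  proof -
    have "I \<noteq> {}" using I unfolding perm_interval_def by auto
    then show ?thesis
      using perm_interval_imp_homogeneous[OF assms I] prime unfolding prime_set_def is_singleton_def by blast
  qed
  then show "simple \<sigma>" using assms unfolding simple_def by blast
qed

lemma simple_perm: "simple \<sigma> \<Longrightarrow> perm \<sigma>"
  unfolding simple_def by blast

lemma simple_prime: "simple \<sigma> \<Longrightarrow> prime_set (col \<sigma>) {..<length \<sigma>}"
  using simple_iff_prime[OF simple_perm] by simp

section \<open>Standardization, deletion and insertion\<close>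

lemma card_le_less:
  fixes x y :: nat
  assumes "finite A" "x \<in> A" "y \<in> A"
  shows "card {z \<in> A. z \<le> x} < card {z \<in> A. z \<le> y} \<longleftrightarrow> x < y"
proof -
  have mono: "card {z \<in> A. z \<le> x} < card {z \<in> A. z \<le> y}" if "x < y" "y \<in> A" for x y
  proof (rule psubset_card_mono)
    have "y \<in> {z \<in> A. z \<le> y}" "y \<notin> {z \<in> A. z \<le> x}" using that by auto
    moreover have "{z \<in> A. z \<le> x} \<subseteq> {z \<in> A. z \<le> y}" using that by auto
    ultimately show "{z \<in> A. z \<le> x} \<subset> {z \<in> A. z \<le> y}" by blast
  qed (use assms(1) in simp)
  show ?thesis
    using mono[of x y] mono[of y x] assms(2,3) by (cases x y rule: linorder_cases) auto
qed

lemma order_isomorphic_standardize: "order_isomorphic (standardize xs) xs"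
  unfolding order_isomorphic_def standardize_def by (simp add: card_le_less)

lemma perm_standardize:
  assumes "xs \<noteq> []" "distinct xs"
  shows "perm (standardize xs)"
proof (rule permI)
  have "inj_on (\<lambda>x. card {y \<in> set xs. y \<le> x}) (set xs)"
  proof (rule inj_onI)
    fix x y assume "x \<in> set xs" "y \<in> set xs" "card {z \<in> set xs. z \<le> x} = card {z \<in> set xs. z \<le> y}"
    then have "\<not> x < y" "\<not> y < x"
      using card_le_less[of "set xs" x y] card_le_less[of "set xs" y x] by simp_all
    then show "x = y" by simp
  qed
  then show "distinct (standardize xs)" unfolding standardize_def using assms(2) by (simp add: distinct_map)
  have "card {y \<in> set xs. y \<le> x} \<in> {1..length xs}" if "x \<in> set xs" for x
  proof -
    have "card {y \<in> set xs. y \<le> x} \<le> card (set xs)" by (rule card_mono) auto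
    then have "card {y \<in> set xs. y \<le> x} \<le> length xs" using card_length le_trans by blast
    moreover have "{y \<in> set xs. y \<le> x} \<noteq> {}" using that by auto
    then have "0 < card {y \<in> set xs. y \<le> x}" by (simp add: card_gt_0_iff)
    ultimately show ?thesis by simp
  qed
  then show "set (standardize xs) \<subseteq> {1..length (standardize xs)}" unfolding standardize_def by auto
qed (use assms in \<open>simp add: standardize_def\<close>)

context
  fixes \<sigma> :: "nat list" and i :: nat
  assumes \<sigma>: "perm \<sigma>" and i: "i < length \<sigma>" and n: "2 \<le> length \<sigma>"
begin

lemma length_delete_point: "length (delete_point i \<sigma>) = length \<sigma> - 1"
  unfolding delete_point_def standardize_def using i by simp

lemma perm_delete_point: "perm (delete_point i \<sigma>)"
  unfolding delete_point_def
proof (rule perm_standardize)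
  have "distinct \<sigma>" using \<sigma> unfolding perm_iff by blast
  then have "distinct (take i \<sigma> @ \<sigma> ! i # drop (Suc i) \<sigma>)" using id_take_nth_drop[OF i] by simp
  then show "distinct (take i \<sigma> @ drop (Suc i) \<sigma>)" by simp
  have "length (take i \<sigma> @ drop (Suc i) \<sigma>) \<noteq> 0" using i n by simp
  then show "take i \<sigma> @ drop (Suc i) \<sigma> \<noteq> []" by force
qed

text \<open>Standardizing changes no comparison, so the deletion is, as a coloured set, the set of
  positions other than \<open>i\<close>; \<open>h\<close> is the increasing enumeration that skips
  \<open>i\<close>.\<close>

lemma delete_point_skip:
  defines "h \<equiv> \<lambda>l. if l < i then l else Suc l"
  shows "inj_on h {..<length (delete_point i \<sigma>)}"
    and "h ` {..<length (delete_point i \<sigma>)} = {..<length \<sigma>} - {i}"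
    and "\<And>k l. k < length (delete_point i \<sigma>) \<Longrightarrow> l < length (delete_point i \<sigma>) \<Longrightarrow>
      col \<sigma> (h k) (h l) = col (delete_point i \<sigma>) k l"
proof -
  show "inj_on h {..<length (delete_point i \<sigma>)}" unfolding h_def by (auto intro!: inj_onI split: if_splits)
  show "h ` {..<length (delete_point i \<sigma>)} = {..<length \<sigma>} - {i}"
  proof
    show "{..<length \<sigma>} - {i} \<subseteq> h ` {..<length (delete_point i \<sigma>)}"
    proof
      fix l assume l: "l \<in> {..<length \<sigma>} - {i}"
      then have "l = h (if l < i then l else l - 1)" unfolding h_def by auto
      moreover have "(if l < i then l else l - 1) < length (delete_point i \<sigma>)"
        unfolding length_delete_point using l i by auto
      ultimately show "l \<in> h ` {..<length (delete_point i \<sigma>)}" by blast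
    qed
  qed (use i in \<open>auto simp: length_delete_point h_def\<close>)
  fix k l assume kl: "k < length (delete_point i \<sigma>)" "l < length (delete_point i \<sigma>)"
  let ?xs = "take i \<sigma> @ drop (Suc i) \<sigma>"
  have nth: "?xs ! l = \<sigma> ! h l" "h l < length \<sigma>" if "l < length (delete_point i \<sigma>)" for l
    using that i unfolding length_delete_point h_def by (auto simp: nth_append)
  have "(delete_point i \<sigma> ! k < delete_point i \<sigma> ! l) = (?xs ! k < ?xs ! l)"
    using order_isomorphic_standardize[of ?xs] kl unfolding order_isomorphic_def delete_point_def by blast
  moreover have "(h k < h l) = (k < l)" unfolding h_def by auto
  ultimately show "col \<sigma> (h k) (h l) = col (delete_point i \<sigma>) k l"
    using nth kl unfolding colour_def val_def by simp
qed

lemma embeds_delete_point: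
  "embeds (col (delete_point i \<sigma>)) {..<length (delete_point i \<sigma>)} (col \<sigma>) ({..<length \<sigma>} - {i})"
  unfolding embeds_def
proof (intro exI conjI ballI impI)
  show "inj_on (\<lambda>l. if l < i then l else Suc l) {..<length (delete_point i \<sigma>)}"
    by (rule delete_point_skip(1))
  show "(\<lambda>l. if l < i then l else Suc l) ` {..<length (delete_point i \<sigma>)} \<subseteq> {..<length \<sigma>} - {i}"
    by (rule equalityD1[OF delete_point_skip(2)])
qed (rule delete_point_skip(3); simp)

lemma prime_delete_point:
  "prime_set (col (delete_point i \<sigma>)) {..<length (delete_point i \<sigma>)} \<longleftrightarrow>
    prime_set (col \<sigma>) ({..<length \<sigma>} - {i})"
  and embeds_into_delete_point:
  "embeds (col \<sigma>) ({..<length \<sigma>} - {i}) (col (delete_point i \<sigma>)) {..<length (delete_point i \<sigma>)}"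
proof -
  let ?D = "{..<length (delete_point i \<sigma>)}" and ?h = "\<lambda>l. if l < i then l else Suc l"
  let ?g = "inv_into ?D ?h"
  note inj = delete_point_skip(1) and img = delete_point_skip(2) and eq = delete_point_skip(3)
  have g: "?g l \<in> ?D" "?h (?g l) = l" if "l \<in> {..<length \<sigma>} - {i}" for l
  proof -
    have "l \<in> ?h ` ?D" unfolding img using that .
    from inv_into_into[OF this] f_inv_into_f[OF this] show "?g l \<in> ?D" "?h (?g l) = l" .
  qed
  have geq: "col (delete_point i \<sigma>) (?g k) (?g l) = col \<sigma> k l"
    if "k \<in> {..<length \<sigma>} - {i}" "l \<in> {..<length \<sigma>} - {i}" for k l
    using eq[of "?g k" "?g l"] g[OF that(1)] g[OF that(2)] by simp
  have ginj: "inj_on ?g ({..<length \<sigma>} - {i})"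
    using inj_on_inv_into[of "{..<length \<sigma>} - {i}" ?h ?D] img by blast
  have gimg: "?g ` ({..<length \<sigma>} - {i}) = ?D"
    using inv_into_image_cancel[OF inj, of ?D] img by simp
  show "embeds (col \<sigma>) ({..<length \<sigma>} - {i}) (col (delete_point i \<sigma>)) ?D"
    unfolding embeds_def using ginj gimg geq by (intro exI[of _ ?g]) simp
  show "prime_set (col (delete_point i \<sigma>)) ?D \<longleftrightarrow> prime_set (col \<sigma>) ({..<length \<sigma>} - {i})"
  proof
    assume prime: "prime_set (col (delete_point i \<sigma>)) ?D"
    have "prime_set (col \<sigma>) (?h ` ?D)"
      by (rule prime_set_image[OF inj _ prime], rule eq) simp_all
    then show "prime_set (col \<sigma>) ({..<length \<sigma>} - {i})" unfolding img .
  next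
    assume prime: "prime_set (col \<sigma>) ({..<length \<sigma>} - {i})"
    have "prime_set (col (delete_point i \<sigma>)) (?g ` ({..<length \<sigma>} - {i}))"
      by (rule prime_set_image[OF ginj _ prime], rule geq)
    then show "prime_set (col (delete_point i \<sigma>)) ?D" unfolding gimg .
  qed
qed

lemma simple_delete_point:
  "simple (delete_point i \<sigma>) \<longleftrightarrow> prime_set (col \<sigma>) ({..<length \<sigma>} - {i})"
  by (simp only: simple_iff_prime[OF perm_delete_point] prime_delete_point)

text \<open>Inserting the removed value at its old position undoes the standardization. Together
  with \<open>insertions_imp_deletions\<close> this translates rule (a) of the loop into a statement
  about deletions.\<close>

lemma insert_delete_point: "\<sigma> \<in> insertions (delete_point i \<sigma>)"
proof -
  let ?v = "\<sigma> ! i" and ?xs = "take i \<sigma> @ drop (Suc i) \<sigma>"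
  have split: "\<sigma> = take i \<sigma> @ ?v # drop (Suc i) \<sigma>" by (rule id_take_nth_drop[OF i])
  have dist: "distinct (take i \<sigma> @ ?v # drop (Suc i) \<sigma>)" using \<sigma> split unfolding perm_iff by metis
  have set: "set ?xs = {1..length \<sigma>} - {?v}"
  proof -
    have "set \<sigma> = insert ?v (set ?xs)" using arg_cong[OF split, of set] by simp
    moreover have "?v \<notin> set ?xs" using dist by auto
    ultimately show ?thesis using \<sigma> unfolding perm_iff by auto
  qed
  have v: "?v \<in> {1..length \<sigma>}" using \<sigma> nth_mem[OF i] unfolding perm_iff by blast
  \<comment> \<open>Only the value \<open>?v\<close> is missing, so ranks equal values below it and
    are one less above it.\<close>
  have rank: "card {y \<in> set ?xs. y \<le> x} = (if x < ?v then x else x - 1)" if "x \<in> set ?xs" for x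
  proof (cases "x < ?v")
    case True
    then have "{y \<in> set ?xs. y \<le> x} = {1..x}" using that v unfolding set by auto
    then show ?thesis using True by simp
  next
    case False
    then have "{y \<in> set ?xs. y \<le> x} = {1..x} - {?v}" using that v unfolding set by auto
    then show ?thesis using False v by simp
  qed
  have "map (\<lambda>x. if x < ?v then x else Suc x) (delete_point i \<sigma>) = ?xs"
    unfolding delete_point_def standardize_def map_map
  proof (rule map_idI)
    fix x assume x: "x \<in> set ?xs"
    then have "x \<noteq> ?v" "1 \<le> x" unfolding set by auto
    then show "((\<lambda>x. if x < ?v then x else Suc x) \<circ> (\<lambda>x. card {y \<in> set ?xs. y \<le> x})) x = x"
      unfolding comp_def rank[OF x] by auto
  qed
  then have "insert_point i ?v (delete_point i \<sigma>) = \<sigma>"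
    unfolding insert_point_def Let_def using split[symmetric] i by simp
  moreover have "i \<le> length (delete_point i \<sigma>)" "?v \<in> {1..Suc (length (delete_point i \<sigma>))}"
    using i v unfolding length_delete_point by auto
  ultimately show ?thesis unfolding insertions_def by force
qed

end

lemma insertions_imp_deletions:
  assumes "perm \<pi>" "\<sigma> \<in> insertions \<pi>"
  obtains i where "i < length \<sigma>" "delete_point i \<sigma> = \<pi>"
proof -
  obtain i v where i: "\<sigma> = insert_point i v \<pi>" "i \<le> length \<pi>"
    using assms(2) unfolding insertions_def by blast
  define f where "f x = (if x < v then x else Suc x)" for x
  have mono: "f x \<le> f y \<longleftrightarrow> x \<le> y" for x y unfolding f_def by auto
  have inj: "inj f" by (rule injI) (metis eq_iff mono)
  have \<sigma>: "\<sigma> = take i (map f \<pi>) @ v # drop i (map f \<pi>)"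
    unfolding i(1) insert_point_def Let_def f_def ..
  have del: "take i \<sigma> @ drop (Suc i) \<sigma> = map f \<pi>" unfolding \<sigma> using i(2) by simp
  have "standardize (map f \<pi>) = \<pi>"
    unfolding standardize_def map_map
  proof (rule map_idI)
    fix x assume x: "x \<in> set \<pi>"
    have "{y \<in> set (map f \<pi>). y \<le> f x} = f ` {y \<in> set \<pi>. y \<le> x}" using mono by auto
    also have "{y \<in> set \<pi>. y \<le> x} = {1..x}" using x assms(1) unfolding perm_iff by auto
    finally show "((\<lambda>x. card {y \<in> set (map f \<pi>). y \<le> x}) \<circ> f) x = x"
      using inj by (simp add: card_image inj_on_subset[OF inj])
  qed
  then have "delete_point i \<sigma> = \<pi>" unfolding delete_point_def del .
  moreover have "i < length \<sigma>" unfolding \<sigma> using i(2) by simp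
  ultimately show thesis using that by blast
qed

section \<open>Exceptional permutations and the algorithm\<close>

lemma nth_concat_pairs:
  "i < 2 * length xs \<Longrightarrow> concat (map (\<lambda>k. [f k, g k]) xs) ! i = (if even i then f (xs ! (i div 2)) else g (xs ! (i div 2)))"
proof (induction xs arbitrary: i)
  case (Cons x xs)
  show ?case
  proof (cases i)
    case (Suc j)
    then show ?thesis using Cons by (cases j) auto
  qed simp
qed simp

lemma length_concat_pairs: "length (concat (map (\<lambda>k. [f k, g k]) xs)) = 2 * length xs"
  by (induction xs) auto

lemma length_exceptional: "length (exceptional t m) = 2 * m"
  by (cases t) (simp_all add: length_concat_pairs del: upt_Suc)

text \<open>
  The position and the value of the points of an exceptional permutation along its zigzag: by
  increasing value for type 1, by decreasing value for type 2, by position for types 3 and 4.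
\<close>

fun exc_pos :: "exc_type \<Rightarrow> nat \<Rightarrow> nat \<Rightarrow> nat" where
  "exc_pos Type1 m i = (if odd i then i div 2 else m + i div 2)"
| "exc_pos Type2 m i = (if odd i then i div 2 else m + i div 2)"
| "exc_pos Type3 m i = i"
| "exc_pos Type4 m i = i"

fun exc_val :: "exc_type \<Rightarrow> nat \<Rightarrow> nat \<Rightarrow> nat" where
  "exc_val Type1 m i = Suc i"
| "exc_val Type2 m i = 2 * m - i"
| "exc_val Type3 m i = (if even i then m + Suc (i div 2) else Suc (i div 2))"
| "exc_val Type4 m i = (if even i then m - i div 2 else 2 * m - i div 2)"

text \<open>The colours \<open>A\<close> and \<open>B\<close> of the zigzag. Fixing the first
  component of \<open>exc_rest\<close> as \<open>True\<close> fixes the direction of reading; the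
  four types are then exactly the pairs in which \<open>exc_cross\<close> is neither
  \<open>exc_rest\<close> nor its reverse.\<close>

fun exc_cross :: "exc_type \<Rightarrow> bool \<times> bool" where
  "exc_cross Type1 = (False, True)"
| "exc_cross Type2 = (False, False)"
| "exc_cross Type3 = (True, False)"
| "exc_cross Type4 = (True, True)"

fun exc_rest :: "exc_type \<Rightarrow> bool \<times> bool" where
  "exc_rest Type1 = (True, True)"
| "exc_rest Type2 = (True, False)"
| "exc_rest Type3 = (True, True)"
| "exc_rest Type4 = (True, False)"

lemma exceptional_nth:
  assumes "i < 2 * m"
  shows "exceptional t m ! exc_pos t m i = exc_val t m i"
proof -
  define k where "k = i div 2"
  have "k < m" unfolding k_def using assms by linarith
  then obtain d where m: "m = Suc (k + d)" using less_imp_Suc_add by blast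
  consider "i = 2 * k" | "i = Suc (2 * k)" unfolding k_def by linarith
  then show ?thesis
    unfolding m
    by cases (cases t; simp add: nth_append rev_nth nth_concat_pairs del: upt_Suc)+
qed

lemma inj_on_exc_pos: "inj_on (exc_pos t m) {..<2 * m}"
proof (rule inj_onI)
  fix i j assume ij: "i \<in> {..<2 * m}" "j \<in> {..<2 * m}" "exc_pos t m i = exc_pos t m j"
  have "i div 2 < m" "j div 2 < m" using ij by auto
  then have "(even i = even j \<and> i div 2 = j div 2) \<or> i = j"
    using ij(3) by (cases t) (auto split: if_splits)
  then show "i = j" by (metis even_two_times_div_two odd_two_times_div_two_succ)
qed

lemma exc_pos_image: "exc_pos t m ` {..<2 * m} = {..<2 * m}"
proof (rule card_subset_eq)
  show "exc_pos t m ` {..<2 * m} \<subseteq> {..<2 * m}" by (cases t) auto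
  show "card (exc_pos t m ` {..<2 * m}) = card {..<2 * m}" by (rule card_image[OF inj_on_exc_pos])
qed simp

lemma perm_exceptional:
  assumes "1 \<le> m"
  shows "perm (exceptional t m)"
proof (rule permI)
  let ?\<sigma> = "exceptional t m"
  have inj: "i = j" if "i < 2 * m" "j < 2 * m" "exc_val t m i = exc_val t m j" for i j
  proof -
    have "i div 2 < m" "j div 2 < m" using that by auto
    then have "(even i = even j \<and> i div 2 = j div 2) \<or> i = j"
      using that by (cases t) (auto split: if_splits)
    then show "i = j" by (metis even_two_times_div_two odd_two_times_div_two_succ)
  qed
  have pos: "\<exists>i<2 * m. a = exc_pos t m i" if "a < 2 * m" for a
    using exc_pos_image[of t m] that by (metis imageE lessThan_iff)
  show "distinct ?\<sigma>"
    unfolding distinct_conv_nth length_exceptional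
    using pos exceptional_nth inj by metis
  show "set ?\<sigma> \<subseteq> {1..length ?\<sigma>}"
  proof
    fix x assume "x \<in> set ?\<sigma>"
    then obtain a where "a < 2 * m" "x = ?\<sigma> ! a" by (auto simp: in_set_conv_nth length_exceptional)
    then obtain i where i: "i < 2 * m" "x = exc_val t m i" using pos exceptional_nth by metis
    moreover have "i div 2 < m" using i by auto
    ultimately show "x \<in> {1..length ?\<sigma>}" unfolding length_exceptional by (cases t) auto
  qed
  show "?\<sigma> \<noteq> []" using assms length_exceptional[of t m] by force
qed

lemma zigzag_exceptional:
  "zigzag (col (exceptional t m)) m (exc_pos t m) (exc_cross t) (exc_rest t)"
  unfolding zigzag_def
proof (intro conjI allI impI inj_on_exc_pos)
  fix i j assume j: "j < 2 * m" and ij: "i < j"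
  have i: "i < 2 * m" using ij j by simp
  have pos: "exc_pos t m k < 2 * m" if "k < 2 * m" for k using exc_pos_image[of t m] that by blast
  have val: "val (exceptional t m) (exc_pos t m k) = exc_val t m k" if "k < 2 * m" for k
    unfolding val_def length_exceptional using pos exceptional_nth that by simp
  have div: "i div 2 < m" "j div 2 < m" "i div 2 \<le> j div 2" using i j ij by (auto simp: div_le_mono)
  have div_less: "i div 2 < j div 2" if "even i = even j \<or> odd i"
    using that ij by (auto elim!: evenE oddE)
  show "col (exceptional t m) (exc_pos t m i) (exc_pos t m j) =
      (if even i \<and> odd j then exc_cross t else exc_rest t)"
    unfolding colour_def val[OF i] val[OF j] using div div_less i j ij by (cases t) auto
qed

lemma colour_swap: "inj s \<Longrightarrow> i \<noteq> j \<Longrightarrow> colour s j i = (\<not> fst (colour s i j), \<not> snd (colour s i j))"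
  unfolding colour_def by (auto simp: inj_eq not_less_iff_gr_or_eq)

lemma zigzag_embeds:
  assumes s: "inj s" "inj r" and z: "zigzag (colour s) m p A B" "zigzag (colour r) m q A B"
  shows "embeds (colour s) (p ` {..<2 * m}) (colour r) (q ` {..<2 * m})"
proof -
  let ?ix = "inv_into {..<2 * m} p"
  have inj: "inj_on p {..<2 * m}" "inj_on q {..<2 * m}" using z unfolding zigzag_def by blast+
  have ix: "?ix (p i) = i" if "i < 2 * m" for i using inv_into_f_f[OF inj(1)] that by simp
  have less: "colour r (q i) (q j) = colour s (p i) (p j)" if "i < j" "j < 2 * m" for i j
    using z that unfolding zigzag_def by simp
  have all: "colour r (q i) (q j) = colour s (p i) (p j)" if "i < 2 * m" "j < 2 * m" "i \<noteq> j" for i j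
  proof (cases "i < j")
    case False
    then have "j < i" using that by simp
    have "q i \<noteq> q j" "p i \<noteq> p j" using inj that unfolding inj_on_def by auto
    then show ?thesis using less[OF \<open>j < i\<close> that(1)] colour_swap s by metis
  qed (use less that in simp)
  show ?thesis unfolding embeds_def
  proof (intro exI[of _ "q \<circ> ?ix"] conjI ballI impI)
    show "inj_on (q \<circ> ?ix) (p ` {..<2 * m})"
    proof (rule inj_onI)
      fix x y assume xy: "x \<in> p ` {..<2 * m}" "y \<in> p ` {..<2 * m}" "(q \<circ> ?ix) x = (q \<circ> ?ix) y"
      then obtain i j where ij: "x = p i" "y = p j" "i < 2 * m" "j < 2 * m" by blast
      then have "q i = q j" using xy(3) ix by simp
      then show "x = y" using ij inj(2) unfolding inj_on_def by auto
    qed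
    show "(q \<circ> ?ix) ` p ` {..<2 * m} \<subseteq> q ` {..<2 * m}" using ix by auto
    fix a b assume "a \<in> p ` {..<2 * m}" "b \<in> p ` {..<2 * m}" "a \<noteq> b"
    then obtain i j where "a = p i" "b = p j" "i < 2 * m" "j < 2 * m" "i \<noteq> j" by blast
    then show "colour r ((q \<circ> ?ix) a) ((q \<circ> ?ix) b) = colour s a b" using ix all by simp
  qed
qed

text \<open>The map from \<open>i\<close> to \<open>2 * m - 1 - i\<close> reverses both order and
  parity, so pairs of an even and a later odd index stay such pairs, while every colour is
  reversed.\<close>

lemma zigzag_rev:
  assumes "inj s" "zigzag (colour s) m p A B"
  shows "zigzag (colour s) m (\<lambda>i. p (2 * m - 1 - i)) (\<not> fst A, \<not> snd A) (\<not> fst B, \<not> snd B)"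
  unfolding zigzag_def
proof (intro conjI allI impI)
  have inj: "inj_on p {..<2 * m}" using assms(2) unfolding zigzag_def by blast
  then show "inj_on (\<lambda>i. p (2 * m - 1 - i)) {..<2 * m}" unfolding inj_on_def by force
  fix i j assume ij: "j < 2 * m" "i < j"
  let ?i = "2 * m - 1 - i" and ?j = "2 * m - 1 - j"
  have lt: "?j < ?i" "?i < 2 * m" using ij by auto
  then have neq: "p ?j \<noteq> p ?i" using inj unfolding inj_on_def by force
  have "colour s (p ?j) (p ?i) = (if even ?j \<and> odd ?i then A else B)"
    using assms(2) lt unfolding zigzag_def by blast
  moreover have "even ?j = odd j" "odd ?i = even i" using ij by auto
  ultimately show "colour s (p ?i) (p ?j) =
      (if even i \<and> odd j then (\<not> fst A, \<not> snd A) else (\<not> fst B, \<not> snd B))"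
    using colour_swap[OF assms(1) neq] by auto
qed

text \<open>Reversing the zigzag if necessary makes the first component of \<open>B\<close> true,
  and only the four pairs of \<open>exc_cross\<close> and \<open>exc_rest\<close> remain. Zigzags
  with equal parameters are isomorphic, and a pattern of full size is the whole permutation.\<close>

lemma zigzag_imp_exceptional:
  assumes \<sigma>: "perm \<sigma>" and z: "zigzag (col \<sigma>) m p A B" and p: "p ` {..<2 * m} = {..<length \<sigma>}"
    and AB: "A \<noteq> B" "col \<sigma> (p 1) (p 0) \<noteq> B"
  shows "\<exists>t. \<sigma> = exceptional t m"
proof -
  have len: "length \<sigma> = 2 * m"
    using z p card_image[of p "{..<2 * m}"] unfolding zigzag_def by simp
  have m: "1 \<le> m" using len \<sigma> unfolding perm_iff by (cases m) auto
  note inj = inj_val[OF \<sigma>]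
  have "p 0 \<noteq> p 1" "col \<sigma> (p 0) (p 1) = A"
    using z m unfolding zigzag_def by (auto dest: inj_onD)
  then have B: "B \<noteq> (\<not> fst A, \<not> snd A)" using AB(2) colour_swap[OF inj, of "p 0" "p 1"] by auto
  have main: "\<sigma> = exceptional t m"
    if z: "zigzag (col \<sigma>) m q (exc_cross t) (exc_rest t)" and q: "q ` {..<2 * m} = {..<length \<sigma>}" for q t
  proof -
    have "embeds (col (exceptional t m)) (exc_pos t m ` {..<2 * m}) (col \<sigma>) (q ` {..<2 * m})"
      by (rule zigzag_embeds[OF inj_val[OF perm_exceptional[OF m]] inj zigzag_exceptional z])
    then have "is_pattern (exceptional t m) \<sigma>"
      unfolding is_pattern_iff_embeds[OF perm_exceptional[OF m] \<sigma>] exc_pos_image q length_exceptional .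
    then show ?thesis
      using is_pattern_same_length[OF perm_exceptional[OF m] \<sigma>] len length_exceptional by metis
  qed
  let ?q = "\<lambda>i. p (2 * m - 1 - i)"
  have "(\<lambda>i. 2 * m - 1 - i) ` {..<2 * m} = {..<2 * m}"
  proof
    show "{..<2 * m} \<subseteq> (\<lambda>i. 2 * m - 1 - i) ` {..<2 * m}"
    proof
      fix i assume "i \<in> {..<2 * m}"
      then show "i \<in> (\<lambda>i. 2 * m - 1 - i) ` {..<2 * m}" by (intro image_eqI[of _ _ "2 * m - 1 - i"]) auto
    qed
  qed auto
  then have q: "?q ` {..<2 * m} = {..<length \<sigma>}" using p image_image[of p "\<lambda>i. 2 * m - 1 - i"] by metis
  note zq = zigzag_rev[OF inj z]
  have types: "\<exists>t. A' = exc_cross t \<and> B' = exc_rest t"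
    if neq: "fst B'" "A' \<noteq> B'" "B' \<noteq> (\<not> fst A', \<not> snd A')" for A' B'
  proof -
    consider "A' = (True, False)" "B' = (True, True)" | "A' = (False, True)" "B' = (True, True)"
      | "A' = (True, True)" "B' = (True, False)" | "A' = (False, False)" "B' = (True, False)"
      using neq by (cases A'; cases B') auto
    then show ?thesis
    proof cases
      case 1
      then show ?thesis by (intro exI[of _ Type3]) simp
    next
      case 2
      then show ?thesis by (intro exI[of _ Type1]) simp
    next
      case 3
      then show ?thesis by (intro exI[of _ Type4]) simp
    next
      case 4
      then show ?thesis by (intro exI[of _ Type2]) simp
    qed
  qed
  show ?thesis
  proof (cases "fst B")
    case True
    then obtain t where "A = exc_cross t" "B = exc_rest t" using types AB(1) B by blast
    then show ?thesis using main z p by blast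
  next
    case False
    have "(\<not> fst A, \<not> snd A) \<noteq> (\<not> fst B, \<not> snd B)"
      "(\<not> fst B, \<not> snd B) \<noteq> (\<not> fst (\<not> fst A, \<not> snd A), \<not> snd (\<not> fst A, \<not> snd A))"
      using AB(1) B by (auto simp: prod_eq_iff)
    moreover have "fst (\<not> fst B, \<not> snd B)" using False by simp
    ultimately obtain t where "(\<not> fst A, \<not> snd A) = exc_cross t" "(\<not> fst B, \<not> snd B) = exc_rest t"
      using types by metis
    then show ?thesis using main[of ?q] zq q by metis
  qed
qed

section \<open>Simplicity and simple patterns of exceptional permutations\<close>

lemma exc_not_reverse: "exc_cross t \<noteq> exc_rest t" "exc_rest t \<noteq> (\<not> fst (exc_cross t), \<not> snd (exc_cross t))"
  by (cases t; simp)+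

lemma simple_exceptional:
  assumes "1 \<le> m"
  shows "simple (exceptional t m)"
proof -
  let ?\<sigma> = "exceptional t m"
  note perm = perm_exceptional[OF assms]
  interpret order_colouring "col ?\<sigma>" by (rule order_colouring_col[OF perm])
  have "exc_pos t m 0 \<noteq> exc_pos t m 1"
    using zigzag_inj[OF zigzag_exceptional, of 0 1] assms by simp
  moreover have "col ?\<sigma> (exc_pos t m 0) (exc_pos t m 1) = exc_cross t"
    using zigzag_up[OF zigzag_exceptional, of 0 1] assms by simp
  ultimately have "col ?\<sigma> (exc_pos t m 1) (exc_pos t m 0) \<noteq> exc_rest t"
    using colour_swap[OF inj_val[OF perm]] exc_not_reverse(2) by metis
  then have "prime_set (col ?\<sigma>) (exc_pos t m ` {..<2 * m})"
    by (rule zigzag_prime[OF zigzag_exceptional exc_not_reverse(1)])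
  then show ?thesis unfolding simple_iff_prime[OF perm] length_exceptional exc_pos_image .
qed

lemma exceptional_delete_not_simple:
  assumes "2 \<le> m" "i < 2 * m"
  shows "\<not> simple (delete_point i (exceptional t m))"
proof -
  have perm: "perm (exceptional t m)" using perm_exceptional assms by simp
  interpret order_colouring "col (exceptional t m)" by (rule order_colouring_col[OF perm])
  obtain k where "k < 2 * m" "i = exc_pos t m k"
    using exc_pos_image[of t m] assms(2) by (metis imageE lessThan_iff)
  then have "\<not> prime_set (col (exceptional t m)) ({..<2 * m} - {i})"
    using zigzag_delete_not_prime[OF zigzag_exceptional assms(1), of k] exc_pos_image by simp
  then show ?thesis
    using simple_delete_point[OF perm, of i] assms length_exceptional[of t m] by simp
qed

lemma is_pattern_refl: "is_pattern \<sigma> \<sigma>"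
  unfolding is_pattern_def order_isomorphic_def by blast

lemma is_pattern_trans:
  assumes "perm \<pi>" "perm \<rho>" "perm \<sigma>" "is_pattern \<pi> \<rho>" "is_pattern \<rho> \<sigma>"
  shows "is_pattern \<pi> \<sigma>"
proof -
  have "embeds (col \<pi>) {..<length \<pi>} (col \<rho>) {..<length \<rho>}"
    using assms(4) unfolding is_pattern_iff_embeds[OF assms(1,2)] .
  moreover have "embeds (col \<rho>) {..<length \<rho>} (col \<sigma>) {..<length \<sigma>}"
    using assms(5) unfolding is_pattern_iff_embeds[OF assms(2,3)] .
  ultimately show ?thesis unfolding is_pattern_iff_embeds[OF assms(1,3)] by (rule embeds_trans)
qed

text \<open>An initial segment of a zigzag follows the same colour rule; this places each
  exceptional permutation inside the next one of its type.\<close>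

lemma zigzag_exceptional_shorter:
  "zigzag (col (exceptional t (Suc m))) m (exc_pos t (Suc m)) (exc_cross t) (exc_rest t)"
proof -
  have "inj_on (exc_pos t (Suc m)) {..<2 * m}" by (rule inj_on_subset[OF inj_on_exc_pos]) auto
  then show ?thesis using zigzag_exceptional[of t "Suc m"] unfolding zigzag_def by simp
qed

lemma is_pattern_exceptional_Suc:
  assumes "1 \<le> m"
  shows "is_pattern (exceptional t m) (exceptional t (Suc m))"
proof -
  have perm: "perm (exceptional t m)" "perm (exceptional t (Suc m))" using perm_exceptional assms by auto
  have "embeds (col (exceptional t m)) (exc_pos t m ` {..<2 * m})
      (col (exceptional t (Suc m))) (exc_pos t (Suc m) ` {..<2 * m})"
    by (rule zigzag_embeds[OF perm[THEN inj_val] zigzag_exceptional zigzag_exceptional_shorter])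
  moreover have "exc_pos t (Suc m) ` {..<2 * m} \<subseteq> {..<2 * Suc m}"
    using exc_pos_image[of t "Suc m"] by auto
  ultimately show ?thesis
    unfolding is_pattern_iff_embeds[OF perm] length_exceptional exc_pos_image by (rule embeds_mono)
qed

lemma simple_pattern_prime_subset:
  assumes "simple \<beta>" "perm \<sigma>" "is_pattern \<beta> \<sigma>" "length \<beta> < length \<sigma>"
  obtains X where "X \<subset> {..<length \<sigma>}" "card X = length \<beta>" "prime_set (col \<sigma>) X"
    "embeds (col \<beta>) {..<length \<beta>} (col \<sigma>) X"
proof -
  obtain f where f: "inj_on f {..<length \<beta>}" "f ` {..<length \<beta>} \<subseteq> {..<length \<sigma>}"
    and col_eq: "\<forall>a\<in>{..<length \<beta>}. \<forall>b\<in>{..<length \<beta>}. a \<noteq> b \<longrightarrow> col \<sigma> (f a) (f b) = col \<beta> a b"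
    using assms(3) unfolding is_pattern_iff_embeds[OF simple_perm[OF assms(1)] assms(2)] embeds_def
    by (elim exE conjE)
  have eq: "col \<sigma> (f a) (f b) = col \<beta> a b"
    if "a \<in> {..<length \<beta>}" "b \<in> {..<length \<beta>}" "a \<noteq> b" for a b
    using col_eq that by blast
  have card: "card (f ` {..<length \<beta>}) = length \<beta>" using card_image[OF f(1)] by simp
  then have "f ` {..<length \<beta>} \<noteq> {..<length \<sigma>}" using assms(4) by auto
  then have "f ` {..<length \<beta>} \<subset> {..<length \<sigma>}" using f(2) by blast
  moreover have "prime_set (col \<sigma>) (f ` {..<length \<beta>})"
    by (rule prime_set_image[OF f(1) eq simple_prime[OF assms(1)]])
  moreover have "embeds (col \<beta>) {..<length \<beta>} (col \<sigma>) (f ` {..<length \<beta>})"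
    unfolding embeds_def using f(1) col_eq by (intro exI[of _ f]) simp
  ultimately show thesis using that[OF _ card] by simp
qed

text \<open>The pattern is a proper prime subset of the zigzag, misses two adjacent indices and so
  fits into the first \<open>2 * m\<close> ones. This is why rule (b) need only look at the next
  smaller exceptional permutation.\<close>

lemma simple_pattern_exceptional:
  assumes "simple \<beta>" "3 \<le> length \<beta>" "length \<beta> < 2 * Suc m" "1 \<le> m"
    and "is_pattern \<beta> (exceptional t (Suc m))"
  shows "is_pattern \<beta> (exceptional t m)"
proof -
  let ?\<sigma> = "exceptional t (Suc m)"
  have perm: "perm ?\<sigma>" "perm (exceptional t m)" using perm_exceptional assms by auto
  obtain X where X: "X \<subset> {..<length ?\<sigma>}" "card X = length \<beta>" "prime_set (col ?\<sigma>) X"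
    "embeds (col \<beta>) {..<length \<beta>} (col ?\<sigma>) X"
    using simple_pattern_prime_subset[OF assms(1) perm(1) assms(5)] assms(3) length_exceptional by metis
  interpret order_colouring "col ?\<sigma>" by (rule order_colouring_col[OF perm(1)])
  have "embeds (col ?\<sigma>) X (col ?\<sigma>) (exc_pos t (Suc m) ` {..<2 * m})"
    by (rule zigzag_prime_subset_embeds[OF zigzag_exceptional X(3)])
      (use X assms(2) in \<open>simp_all add: length_exceptional exc_pos_image del: mult_Suc_right\<close>)
  moreover have "embeds (col ?\<sigma>) (exc_pos t (Suc m) ` {..<2 * m}) (col (exceptional t m)) (exc_pos t m ` {..<2 * m})"
    by (rule zigzag_embeds[OF perm[THEN inj_val] zigzag_exceptional_shorter zigzag_exceptional])
  ultimately show ?thesis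
    unfolding is_pattern_iff_embeds[OF simple_perm[OF assms(1)] perm(2)] length_exceptional
    using X(4) embeds_trans exc_pos_image by metis
qed

lemma simple_delete_or_exceptional:
  assumes "simple \<sigma>" "5 \<le> length \<sigma>" "simple \<beta>" "3 \<le> length \<beta>" "length \<beta> < length \<sigma>" "is_pattern \<beta> \<sigma>"
  shows "(\<exists>i<length \<sigma>. simple (delete_point i \<sigma>) \<and> is_pattern \<beta> (delete_point i \<sigma>)) \<or>
    (\<exists>t m. \<sigma> = exceptional t m)"
proof -
  note \<sigma> = simple_perm[OF assms(1)] and \<beta> = simple_perm[OF assms(3)]
  obtain X where X: "X \<subset> {..<length \<sigma>}" "card X = length \<beta>" "prime_set (col \<sigma>) X"
    "embeds (col \<beta>) {..<length \<beta>} (col \<sigma>) X"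
    by (rule simple_pattern_prime_subset[OF assms(3) \<sigma> assms(6,5)])
  interpret order_colouring "col \<sigma>" by (rule order_colouring_col[OF \<sigma>])
  consider i where "i < length \<sigma>" "prime_set (col \<sigma>) ({..<length \<sigma>} - {i})"
      "embeds (col \<sigma>) X (col \<sigma>) ({..<length \<sigma>} - {i})"
    | m p A B where "{..<length \<sigma>} = p ` {..<2 * m}" "zigzag (col \<sigma>) m p A B" "A \<noteq> B" "col \<sigma> (p 1) (p 0) \<noteq> B"
    using prime_set_delete_or_zigzag[OF _ simple_prime[OF assms(1)] _ X(3,1)] assms(2,4) X(2) by auto
  then show ?thesis
  proof cases
    case 1
    have len: "2 \<le> length \<sigma>" using assms(2) by simp
    have "simple (delete_point i \<sigma>)" using simple_delete_point[OF \<sigma> 1(1) len] 1(2) by simp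
    moreover have "is_pattern \<beta> (delete_point i \<sigma>)"
      unfolding is_pattern_iff_embeds[OF \<beta> perm_delete_point[OF \<sigma> 1(1) len]]
      by (rule embeds_trans[OF X(4) embeds_trans[OF 1(3) embeds_into_delete_point[OF \<sigma> 1(1) len]]])
    ultimately show ?thesis using 1(1) by blast
  next
    case 2
    then show ?thesis using zigzag_imp_exceptional[OF \<sigma> 2(2) _ 2(3,4)] by metis
  qed
qed

section \<open>Simple permutations of small size\<close>

lemma exceptional_size_4: "exceptional Type1 2 = [2, 4, 1, 3]" "exceptional Type2 2 = [3, 1, 4, 2]"
  by (simp_all add: numeral_eq_Suc)

text \<open>It supplies the pattern to which the dichotomy is applied for completeness, and it
  excludes simple permutations of size 3.\<close>

lemma simple_contains_size_4:
  assumes "simple \<sigma>" "3 \<le> length \<sigma>"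
  shows "is_pattern [2, 4, 1, 3] \<sigma> \<or> is_pattern [3, 1, 4, 2] \<sigma>"
proof -
  note \<sigma> = simple_perm[OF assms(1)]
  have fin: "finite {..<length \<sigma>}" and card: "3 \<le> card {..<length \<sigma>}" using assms(2) by simp_all
  obtain a b d e where mem: "a \<in> {..<length \<sigma>}" "b \<in> {..<length \<sigma>}" "d \<in> {..<length \<sigma>}" "e \<in> {..<length \<sigma>}"
    and less: "a < b" "b < d" "d < e"
    and pattern: "val \<sigma> b < val \<sigma> e \<and> val \<sigma> e < val \<sigma> a \<and> val \<sigma> a < val \<sigma> d \<or>
      val \<sigma> d < val \<sigma> a \<and> val \<sigma> a < val \<sigma> e \<and> val \<sigma> e < val \<sigma> b"
    by (rule prime_set_contains_pattern[OF inj_val[OF \<sigma>] fin simple_prime[OF assms(1)] card])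
  let ?s = "[\<sigma> ! a, \<sigma> ! b, \<sigma> ! d, \<sigma> ! e]"
  have "subseq ?s \<sigma>"
    unfolding subseq_iff_nth
    by (intro exI[of _ "(!) [a, b, d, e]"]) (use mem less in \<open>auto simp: less_Suc_eq numeral_eq_Suc\<close>)
  moreover have "order_isomorphic ?s [3, 1, 4, 2] \<or> order_isomorphic ?s [2, 4, 1, 3]"
  proof -
    have val: "val \<sigma> i = \<sigma> ! i" if "i \<in> {..<length \<sigma>}" for i using that unfolding val_def by simp
    show ?thesis
      using pattern unfolding mem[THEN val] order_isomorphic_def
      by (elim disjE conjE) (simp_all add: All_less_Suc numeral_eq_Suc)
  qed
  ultimately show ?thesis unfolding is_pattern_def by blast
qed

lemma perm_size_1: "perm \<sigma> \<and> length \<sigma> = 1 \<longleftrightarrow> \<sigma> = [1]"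
  unfolding perm_iff by (auto simp: length_Suc_conv)

lemma perm_size_2: "perm \<sigma> \<and> length \<sigma> = 2 \<longleftrightarrow> \<sigma> = [1, 2] \<or> \<sigma> = [2, 1]"
proof
  have set: "{1..2} = {1, 2::nat}" by auto
  show "\<sigma> = [1, 2] \<or> \<sigma> = [2, 1]" if \<sigma>: "perm \<sigma> \<and> length \<sigma> = 2"
  proof -
    obtain a b where ab: "\<sigma> = [a, b]" using \<sigma> by (auto simp: length_Suc_conv numeral_2_eq_2)
    have "set \<sigma> = {1, 2}" using \<sigma> set unfolding perm_iff by metis
    then have "{a, b} = {1, 2}" using ab by simp
    then show ?thesis unfolding ab doubleton_eq_iff by blast
  qed
  show "perm \<sigma> \<and> length \<sigma> = 2" if "\<sigma> = [1, 2] \<or> \<sigma> = [2, 1]"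
    using that unfolding perm_iff by auto
qed

lemma simple_size_le_2:
  assumes "perm \<sigma>" "length \<sigma> \<le> 2"
  shows "simple \<sigma>"
  unfolding simple_iff_prime[OF assms(1)] prime_set_def
proof (intro allI impI)
  fix M assume "homogeneous (col \<sigma>) {..<length \<sigma>} M"
  then have sub: "M \<subseteq> {..<length \<sigma>}" unfolding homogeneous_def by blast
  then have fin: "finite M" using finite_subset by blast
  show "M = {} \<or> (\<exists>a. M = {a}) \<or> M = {..<length \<sigma>}"
  proof (cases "card M \<le> 1")
    case True
    then show ?thesis using fin by (metis card_0_eq card_1_singletonE le_Suc_eq le_zero_eq One_nat_def)
  next
    case False
    then have "card M = card {..<length \<sigma>}" using card_mono[OF _ sub] assms(2) by simp
    then show ?thesis using sub card_subset_eq by blast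
  qed
qed

lemma is_pattern_delete_point:
  assumes "perm \<sigma>" "i < length \<sigma>" "2 \<le> length \<sigma>"
  shows "is_pattern (delete_point i \<sigma>) \<sigma>"
  unfolding is_pattern_iff_embeds[OF perm_delete_point[OF assms] assms(1)]
  by (rule embeds_mono[OF embeds_delete_point[OF assms]]) blast

section \<open>Correctness of the algorithm\<close>

theorem theorem5p1:
  fixes B :: "nat list set" and n :: nat and Si_n :: "nat list set"
  assumes "finite B"
    and "\<forall>\<beta>\<in>B. simple \<beta>"
    and "[1, 2] \<notin> B" and "[2, 1] \<notin> B"
    and "[1] \<notin> B"
    and "computes B n Si_n"
  shows "Si_n = {\<sigma>. simple \<sigma> \<and> length \<sigma> = n \<and> \<sigma> \<in> Av B}"
proof -
  \<comment> \<open>\<open>[1]\<close>, \<open>[1, 2]\<close> and \<open>[2, 1]\<close> are all the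
    permutations with at most two points, so every basis element has the three points required by
    the lemmas on prime sets.\<close>
  have B_perm: "perm \<beta>" and B_size: "3 \<le> length \<beta>" if "\<beta> \<in> B" for \<beta>
  proof -
    show perm: "perm \<beta>" using assms(2) that simple_perm by blast
    then have "length \<beta> \<noteq> 0" unfolding perm_iff by simp
    moreover have "length \<beta> \<noteq> 1" using perm_size_1[of \<beta>] perm that assms(5) by auto
    moreover have "length \<beta> \<noteq> 2" using perm_size_2[of \<beta>] perm that assms(3,4) by auto
    ultimately show "3 \<le> length \<beta>" by linarith
  qed
  have Av_small: "\<sigma> \<in> Av B" if "perm \<sigma>" "length \<sigma> \<le> 2" for \<sigma>
    using B_size is_pattern_length_le that unfolding Av_def by fastforce
  have Av_pattern: "\<pi> \<in> Av B" if "perm \<pi>" "is_pattern \<pi> \<sigma>" "\<sigma> \<in> Av B" for \<pi> \<sigma>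
    using that is_pattern_trans[OF B_perm \<open>perm \<pi>\<close>] unfolding Av_def by blast
  have size_4: "4 \<le> length \<sigma>" if "simple \<sigma>" "3 \<le> length \<sigma>" for \<sigma>
    using simple_contains_size_4[OF that] is_pattern_length_le by fastforce
  from assms(6) show ?thesis
  proof (induction rule: computes.induct)
    case init1
    have "perm [1]" using perm_size_1 by blast
    then show ?case using perm_size_1 simple_perm simple_size_le_2[of "[1]"] Av_small[of "[1]"] by auto
  next
    case init2
    have "perm [1, 2]" "perm [2, 1]" using perm_size_2 by blast+
    then show ?case
      using perm_size_2 simple_perm simple_size_le_2 Av_small by auto
  next
    case init3
    then show ?case using size_4 by force
  next
    case init4
    have simple: "simple [2, 4, 1, 3]" "simple [3, 1, 4, 2]"
      using simple_exceptional[of 2 Type1] simple_exceptional[of 2 Type2] unfolding exceptional_size_4 by simp_all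
    have "\<sigma> = [2, 4, 1, 3] \<or> \<sigma> = [3, 1, 4, 2]" if "simple \<sigma>" "length \<sigma> = 4" for \<sigma>
      using simple_contains_size_4[OF that(1)] that(2)
        is_pattern_same_length[OF simple_perm[OF simple(1)] simple_perm[OF that(1)]]
        is_pattern_same_length[OF simple_perm[OF simple(2)] simple_perm[OF that(1)]] by force
    \<comment> \<open>A basis element has at least four points, so inside \<sigma> it can only be
      \<sigma> itself, and avoidance reduces to non-membership.\<close>
    moreover have "\<sigma> \<in> Av B \<longleftrightarrow> \<sigma> \<notin> B" if "simple \<sigma>" "length \<sigma> = 4" for \<sigma>
    proof
      show "\<sigma> \<notin> B" if "\<sigma> \<in> Av B" using that is_pattern_refl unfolding Av_def by blast
      show "\<sigma> \<in> Av B" if "\<sigma> \<notin> B"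
        unfolding Av_def
      proof (intro CollectI conjI ballI notI)
        show "perm \<sigma>" using simple_perm \<open>simple \<sigma>\<close> .
        fix \<beta> assume \<beta>: "\<beta> \<in> B" "is_pattern \<beta> \<sigma>"
        then have "length \<beta> = length \<sigma>"
          using size_4[of \<beta>] B_size[of \<beta>] assms(2) is_pattern_length_le[of \<beta> \<sigma>] \<open>length \<sigma> = 4\<close> by simp
        then have "\<beta> = \<sigma>"
          using is_pattern_same_length B_perm[OF \<beta>(1)] simple_perm[OF \<open>simple \<sigma>\<close>] \<beta>(2) by blast
        then show False using \<beta>(1) \<open>\<sigma> \<notin> B\<close> by blast
      qed
    qed
    ultimately show ?case using simple by auto
  next
    case (loop n S1 S2)
    have n: "5 \<le> n" by (rule loop.hyps)
    have S1: "\<sigma> \<in> S1 \<longleftrightarrow> simple \<sigma> \<and> length \<sigma> = n - 1 \<and> \<sigma> \<in> Av B" for \<sigma> using loop.IH(1) by blast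
    have S2: "\<sigma> \<in> S2 \<longleftrightarrow> simple \<sigma> \<and> length \<sigma> = n - 2 \<and> \<sigma> \<in> Av B" for \<sigma> using loop.IH(2) by blast
    have AvI: "\<sigma> \<in> Av B"
      if "simple \<sigma>" "\<sigma> \<notin> B" "\<And>\<beta>. \<beta> \<in> B \<Longrightarrow> length \<beta> < length \<sigma> \<Longrightarrow> \<not> is_pattern \<beta> \<sigma>" for \<sigma>
      unfolding Av_def
    proof (intro CollectI conjI ballI notI)
      show perm: "perm \<sigma>" using simple_perm that(1) .
      fix \<beta> assume \<beta>: "\<beta> \<in> B" "is_pattern \<beta> \<sigma>"
      then have "length \<beta> = length \<sigma>" using that(3) is_pattern_length_le by (meson le_neq_implies_less)
      then have "\<beta> = \<sigma>" using is_pattern_same_length B_perm[OF \<beta>(1)] perm \<beta>(2) by blast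
      then show False using \<beta>(1) that(2) by blast
    qed
    show ?case
    proof (intro set_eqI iffI)
      fix \<sigma> assume "\<sigma> \<in> loop_body B n S1 S2"
      then consider \<pi> where "simple \<sigma>" "length \<sigma> = n" "\<pi> \<in> S1" "\<sigma> \<in> insertions \<pi>" "\<sigma> \<notin> B"
          "\<And>\<tau>. \<tau> \<in> deletions \<sigma> \<Longrightarrow> simple \<tau> \<Longrightarrow> \<tau> \<in> S1"
        | t m where "\<sigma> = exceptional t (Suc m)" "2 \<le> m" "2 * Suc m = n" "exceptional t m \<in> S2" "\<sigma> \<notin> B"
        unfolding loop_body_def by blast
      then show "\<sigma> \<in> {\<sigma>. simple \<sigma> \<and> length \<sigma> = n \<and> \<sigma> \<in> Av B}"
      proof cases
        case 1
        note closed = 1(6)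
        have "\<sigma> \<in> Av B"
        proof (rule AvI[OF 1(1,5)], rule notI)
          fix \<beta> assume \<beta>: "\<beta> \<in> B" "length \<beta> < length \<sigma>" "is_pattern \<beta> \<sigma>"
          have "simple \<beta>" using assms(2) \<beta>(1) by blast
          with simple_delete_or_exceptional[OF 1(1) _ _ B_size[OF \<beta>(1)] \<beta>(2,3)] n 1(2)
          consider i where "i < length \<sigma>" "simple (delete_point i \<sigma>)" "is_pattern \<beta> (delete_point i \<sigma>)"
            | t m where "\<sigma> = exceptional t m" by blast
          then show False
          proof cases
            case (1 i)
            have "delete_point i \<sigma> \<in> S1" using closed 1 unfolding deletions_def by blast
            then show False using S1 \<beta>(1) 1(3) unfolding Av_def by blast
          next
            \<comment> \<open>An exceptional \<sigma> has no simple deletion, whereas rule (a)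
              obtains \<sigma> by insertion into the simple \<pi>; so this case cannot
              occur.\<close>
            case (2 t m)
            have "simple \<pi>" using S1 \<open>\<pi> \<in> S1\<close> by blast
            obtain i where i: "i < length \<sigma>" "delete_point i \<sigma> = \<pi>"
              using insertions_imp_deletions[OF simple_perm[OF \<open>simple \<pi>\<close>] \<open>\<sigma> \<in> insertions \<pi>\<close>] .
            have "length \<sigma> = 2 * m" using 2 length_exceptional by simp
            then show False
              using exceptional_delete_not_simple[of m i t] i 2 \<open>simple \<pi>\<close> n \<open>length \<sigma> = n\<close> by simp
          qed
        qed
        then show ?thesis using 1 by blast
      next
        case 2
        have "simple \<sigma>" unfolding 2(1) by (rule simple_exceptional) simp
        moreover have "\<sigma> \<in> Av B"
        proof (rule AvI[OF \<open>simple \<sigma>\<close> 2(5)], rule notI)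
          fix \<beta> assume \<beta>: "\<beta> \<in> B" "length \<beta> < length \<sigma>" "is_pattern \<beta> \<sigma>"
          have "is_pattern \<beta> (exceptional t m)"
            by (rule simple_pattern_exceptional)
              (use assms(2) B_size \<beta> 2 length_exceptional in auto)
          then show False using S2 2(4) \<beta>(1) unfolding Av_def by blast
        qed
        moreover have "length \<sigma> = n" using 2 length_exceptional by simp
        ultimately show ?thesis by blast
      qed
    next
      fix \<sigma> assume "\<sigma> \<in> {\<sigma>. simple \<sigma> \<and> length \<sigma> = n \<and> \<sigma> \<in> Av B}"
      then have \<sigma>: "simple \<sigma>" "length \<sigma> = n" "\<sigma> \<in> Av B" by blast+
      note perm = simple_perm[OF \<sigma>(1)]
      have "\<sigma> \<notin> B" using \<sigma>(3) is_pattern_refl unfolding Av_def by blast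
      have len: "2 \<le> length \<sigma>" using \<sigma>(2) n by simp
      have deletion: "delete_point i \<sigma> \<in> S1" if "i < length \<sigma>" "simple (delete_point i \<sigma>)" for i
        using S1 that Av_pattern[OF perm_delete_point is_pattern_delete_point \<sigma>(3)] perm len
          length_delete_point[OF perm that(1) len] \<sigma>(2) by simp
      show "\<sigma> \<in> loop_body B n S1 S2"
      proof (cases "\<exists>i<length \<sigma>. simple (delete_point i \<sigma>)")
        case True
        then obtain i where i: "i < length \<sigma>" "simple (delete_point i \<sigma>)" by blast
        have "delete_point i \<sigma> \<in> S1" using deletion i by blast
        moreover have "\<sigma> \<in> insertions (delete_point i \<sigma>)" by (rule insert_delete_point[OF perm i(1) len])
        moreover have "\<forall>\<tau>\<in>deletions \<sigma>. simple \<tau> \<longrightarrow> \<tau> \<in> S1" using deletion unfolding deletions_def by blast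
        ultimately show ?thesis using \<sigma> \<open>\<sigma> \<notin> B\<close> unfolding loop_body_def by blast
      next
        case False
        \<comment> \<open>Without a simple deletion the dichotomy leaves only the exceptional case.
          Any shorter simple pattern serves to invoke it, and one of size 4 always exists.\<close>
        have "\<exists>\<beta>. simple \<beta> \<and> length \<beta> = 4 \<and> is_pattern \<beta> \<sigma>"
          using simple_contains_size_4[OF \<sigma>(1)] simple_exceptional[of 2 Type1] simple_exceptional[of 2 Type2] n \<sigma>(2)
          unfolding exceptional_size_4 by force
        then obtain \<beta> where \<beta>: "simple \<beta>" "length \<beta> = 4" "is_pattern \<beta> \<sigma>" by blast
        obtain t k where k: "\<sigma> = exceptional t k"
          using simple_delete_or_exceptional[OF \<sigma>(1) _ \<beta>(1) _ _ \<beta>(3)] False n \<sigma>(2) \<beta>(2) by auto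
        then have "2 * k = n" using \<sigma>(2) length_exceptional by simp
        \<comment> \<open>\<open>n\<close> is even and at least 5, hence at least 6, so the
          predecessor \<open>m\<close> is at least 2.\<close>
        then obtain m where m: "k = Suc m" "2 \<le> m" using n by (cases k) auto
        have "is_pattern (exceptional t m) \<sigma>" unfolding k m(1) by (rule is_pattern_exceptional_Suc) (use m in simp)
        moreover have "perm (exceptional t m)" by (rule perm_exceptional) (use m in simp)
        ultimately have "exceptional t m \<in> Av B" using Av_pattern \<sigma>(3) by blast
        moreover have "simple (exceptional t m)" by (rule simple_exceptional) (use m in simp)
        ultimately have "exceptional t m \<in> S2"
          using S2 length_exceptional m \<open>2 * k = n\<close> by simp
        then show ?thesis
          using k m \<open>2 * k = n\<close> \<open>\<sigma> \<notin> B\<close> unfolding loop_body_def by blast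
      qed
    qed
  qed
qed

end
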